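(* Let $\lambda=(p,q,r;a,b;x)$ satisfy $p,q,r,a,b\in\mathbb{R}$, ($0<p<r$ or $0<q<r$), $-1<x<1$, $x\ne0$, and suppose that $f(w)={}_2F_1(pw+a,\,qw+b;\,rw;\,x)$ is of closed form, i.e. $R(w):=f(w+1)/f(w)\in\mathbb{C}(w)$. Write $R(w)$ in a canonical form $$R(w)=\frac{S(w+1)}{S(w)}\cdot d\cdot\frac{(w+u_1)\cdots(w+u_m)}{(w+v_1)\cdots(w+v_n)}.$$ Then $m=n$ and, after multiplying $S(w)$ by a suitable nonzero constant, the gamma product formula $$f(w)=S(w)\cdot d^w\cdot\frac{\Gamma(w+u_1)\cdots\Gamma(w+u_m)}{\Gamma(w+v_1)\cdots\Gamma(w+v_m)}$$ holds. If moreover the solution $\lambda$ is non-elementary, then $r$ is an integer, $1\le m=n\le r$, and there exist $m$ integers $s_1,\dots,s_m$, mutually distinct modulo $r$, such that $u_i=s_i/r$ for $i=1,\dots,m$.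
   Context: ${}_2F_1(\alpha,\beta;\gamma;z)=\sum_{k\ge0}\frac{(\alpha)_k(\beta)_k}{(\gamma)_k(1)_k}z^k$; $f(w)$ is a meromorphic function of $w\in\mathbb{C}$. A parameter $\lambda$ for which $f$ is of closed form is called elementary if $f$ has at most finitely many poles in $\mathbb{C}$, and non-elementary otherwise. A representation of $R(w)$ in the displayed form is canonical if $S(w)\in\mathbb{C}(w)$ is a rational function, $d\in\mathbb{C}^\times$, $m,n\in\mathbb{Z}_{\ge0}$, $u_i,v_j\in\mathbb{C}$ with $u_i-v_j\notin\mathbb{Z}$ for all $i,j$, and moreover, if $R(w)\in\mathbb{R}(w)$ (as is the case here), then $S(w)$, $d$, $\prod_i(w+u_i)$ and $\prod_j(w+v_j)$ are all real. Multiplying $S(w)$ by a nonzero real constant does not change the representation. *)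

theory Defs
  imports "HOL-Complex_Analysis.Complex_Analysis"
begin

definition hyp2F1 :: "complex \<Rightarrow> complex \<Rightarrow> complex \<Rightarrow> complex \<Rightarrow> complex" where
  "hyp2F1 \<alpha> \<beta> \<gamma> z =
     (\<Sum>k. (pochhammer \<alpha> k * pochhammer \<beta> k) / (pochhammer \<gamma> k * pochhammer 1 k) * z ^ k)"

text \<open>
  Meromorphic functions on the plane are represented by HOL functions up to equality outside
  a closed discrete set, that is, \<^term>\<open>eventually P (cosparse UNIV)\<close>, written with the
  quantifier \<open>\<forall>\<^sub>\<approx>\<close>. In particular the values that the convention \<open>x / 0 = 0\<close> assigns at the
  points with \<open>r w = 0, -1, -2, \<dots>\<close> in the next definition are irrelevant below.
\<close>

definition hgf ::
  "real \<Rightarrow> real \<Rightarrow> real \<Rightarrow> real \<Rightarrow> real \<Rightarrow> real \<Rightarrow> complex \<Rightarrow> complex" where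
  "hgf p q r a b x w =
     hyp2F1 (of_real p * w + of_real a) (of_real q * w + of_real b) (of_real r * w) (of_real x)"

definition hgf_ratio ::
  "real \<Rightarrow> real \<Rightarrow> real \<Rightarrow> real \<Rightarrow> real \<Rightarrow> real \<Rightarrow> complex \<Rightarrow> complex" where
  "hgf_ratio p q r a b x w = hgf p q r a b x (w + 1) / hgf p q r a b x w"

text \<open>
  \<open>F\<close> is, as a meromorphic function, a quotient of polynomials with coefficients in \<open>K\<close>;
  used for \<open>K = UNIV\<close> (complex rational functions) and \<open>K = \<real>\<close> (real rational functions).
\<close>

definition rational_over :: "complex set \<Rightarrow> (complex \<Rightarrow> complex) \<Rightarrow> bool" where
  "rational_over K F \<longleftrightarrow>
     (\<exists>P Q :: complex poly. Q \<noteq> 0 \<and> (\<forall>i. coeff P i \<in> K \<and> coeff Q i \<in> K) \<and>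
        (\<forall>\<^sub>\<approx>w\<in>UNIV. F w = poly P w / poly Q w))"

definition closed_form :: "real \<Rightarrow> real \<Rightarrow> real \<Rightarrow> real \<Rightarrow> real \<Rightarrow> real \<Rightarrow> bool" where
  "closed_form p q r a b x \<longleftrightarrow> rational_over UNIV (hgf_ratio p q r a b x)"

definition elementary :: "real \<Rightarrow> real \<Rightarrow> real \<Rightarrow> real \<Rightarrow> real \<Rightarrow> real \<Rightarrow> bool" where
  "elementary p q r a b x \<longleftrightarrow>
     closed_form p q r a b x \<and> finite {w. is_pole (hgf p q r a b x) w}"

definition non_elementary :: "real \<Rightarrow> real \<Rightarrow> real \<Rightarrow> real \<Rightarrow> real \<Rightarrow> real \<Rightarrow> bool" where
  "non_elementary p q r a b x \<longleftrightarrow>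
     closed_form p q r a b x \<and> \<not> elementary p q r a b x"

definition canonical_form ::
  "(complex \<Rightarrow> complex) \<Rightarrow> (complex \<Rightarrow> complex) \<Rightarrow> complex \<Rightarrow>
     nat \<Rightarrow> (nat \<Rightarrow> complex) \<Rightarrow> nat \<Rightarrow> (nat \<Rightarrow> complex) \<Rightarrow> bool" where
  "canonical_form R S d m u n v \<longleftrightarrow>
     rational_over UNIV S \<and> \<not> (\<forall>\<^sub>\<approx>w\<in>UNIV. S w = 0) \<and> d \<noteq> 0 \<and>
     (\<forall>i\<in>{1..m}. \<forall>j\<in>{1..n}. u i - v j \<notin> \<int>) \<and>
     (\<forall>\<^sub>\<approx>w\<in>UNIV. R w = S (w + 1) / S w * d * ((\<Prod>i=1..m. w + u i) / (\<Prod>j=1..n. w + v j))) \<and>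
     (rational_over \<real> R \<longrightarrow>
        rational_over \<real> S \<and> d \<in> \<real> \<and>
        (\<forall>k. coeff (\<Prod>i=1..m. [:u i, 1:]) k \<in> \<real>) \<and>
        (\<forall>k. coeff (\<Prod>j=1..n. [:v j, 1:]) k \<in> \<real>))"

end

theory Submission
  imports Defs "HOL-Real_Asymp.Real_Asymp"
begin

text \<open>
  Assume \<open>0 < p < r\<close>. For large real \<open>w\<close>, Euler's integral writes \<open>f(w)\<close> as a quotient of gamma
  values times \<open>I(w) = \<integral> h(t) E(t)\<^sup>w dt\<close> with \<open>h, E > 0\<close> and \<open>E\<close> bounded on \<open>(0, 1)\<close>. The integral is
  log-convex in \<open>w\<close>, so \<open>I(w+1)/I(w)\<close> increases to a limit and, again by log-convexity,
  \<open>f(w+\<sigma>)/f(w)\<close> tends to \<open>D\<^sup>\<sigma>\<close> for some \<open>D > 0\<close> and all \<open>\<sigma> > 0\<close>; no saddle-point analysis is needed.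
  Comparing \<open>\<sigma> = 1\<close> with the canonical form gives \<open>m = n\<close> and \<open>d = D\<close>. The quotient of \<open>f\<close> by the
  gamma product is then \<open>1\<close>-periodic, and the ratio of its values at \<open>s\<close> and \<open>t\<close> equals that at \<open>s+k\<close>
  and \<open>t+k\<close>, which tends to \<open>1\<close>; so the quotient is constant on a half-line, hence everywhere.

  After division by \<open>\<Gamma>(rw)\<close> the formula becomes an identity of entire functions, whose right-hand
  side vanishes far to the left only where \<open>1/\<Gamma>(rw)\<close> does, and there to first order. Comparison with
  the zeros \<open>-u\<^sub>i - k\<close> of \<open>\<Prod>\<^sub>i 1/\<Gamma>(w+u\<^sub>i)\<close> forces \<open>r\<close> and all \<open>r u\<^sub>i\<close> to be integers and
  \<open>u\<^sub>i - u\<^sub>j\<close> not to be one.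
\<close>

section \<open>Shift ratios of log-convex functions\<close>

text \<open>For convex \<open>G = ln F\<close> the slopes over [y-1, y], [y, y+\<sigma>] and
  [y+\<sigma>, y+\<sigma>+1] increase; multiply by \<sigma> and exponentiate. Unit shifts thus
  control all real shifts.\<close>

lemma log_convex_ratio_bounds:
  fixes F :: "real \<Rightarrow> real"
  assumes conv: "convex_on {A<..} (\<lambda>y. ln (F y))" and pos: "\<And>y. y > A \<Longrightarrow> F y > 0"
    and "A < y - 1" and "\<sigma> > 0"
  shows "(F y / F (y - 1)) powr \<sigma> \<le> F (y + \<sigma>) / F y"
    and "F (y + \<sigma>) / F y \<le> (F (y + \<sigma> + 1) / F (y + \<sigma>)) powr \<sigma>"
proof -
  define G where "G = (\<lambda>y. ln (F y))"
  have F: "F z = exp (G z)" if "z > A" for z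
    using pos[OF that] by (simp add: G_def)
  have conv: "G ((1 - t) *\<^sub>R z + t *\<^sub>R w) \<le> (1 - t) * G z + t * G w"
    if "0 \<le> t" "t \<le> 1" "z > A" "w > A" for t z w
    using convex_onD[OF conv, of t z w] that by (simp add: G_def)
  \<comment> \<open>With this weight \<open>y\<close> is
    \<open>(1 - u) * (y - 1) + u * (y + \<sigma>)\<close>, and \<open>y + \<sigma>\<close> is
    \<open>u * y + (1 - u) * (y + \<sigma> + 1)\<close>.\<close>
  define u where "u = 1 / (1 + \<sigma>)"
  have u: "(1 + \<sigma>) * u = 1" "0 \<le> u" "u \<le> 1"
    using \<open>\<sigma> > 0\<close> by (auto simp: u_def)
  have "(1 - u) * (y - 1) + u * (y + \<sigma>) = y - 1 + (1 + \<sigma>) * u"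
    by (simp add: algebra_simps)
  then have "G y \<le> (1 - u) * G (y - 1) + u * G (y + \<sigma>)"
    using conv[of u "y - 1" "y + \<sigma>"] assms(3,4) u by simp
  then have "(1 + \<sigma>) * G y \<le> (1 + \<sigma>) * ((1 - u) * G (y - 1) + u * G (y + \<sigma>))"
    using \<open>\<sigma> > 0\<close> by (intro mult_left_mono) auto
  also have "\<dots> = (1 + \<sigma> - (1 + \<sigma>) * u) * G (y - 1) + ((1 + \<sigma>) * u) * G (y + \<sigma>)"
    by (simp add: algebra_simps)
  finally have 1: "\<sigma> * (G y - G (y - 1)) \<le> G (y + \<sigma>) - G y"
    unfolding u(1) by (simp add: algebra_simps)
  have "u * y + (1 - u) * (y + \<sigma> + 1) = y + \<sigma> + 1 - (1 + \<sigma>) * u"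
    by (simp add: algebra_simps)
  then have "G (y + \<sigma>) \<le> u * G y + (1 - u) * G (y + \<sigma> + 1)"
    using conv[of "1 - u" y "y + \<sigma> + 1"] assms(3,4) u by simp
  then have "(1 + \<sigma>) * G (y + \<sigma>) \<le> (1 + \<sigma>) * (u * G y + (1 - u) * G (y + \<sigma> + 1))"
    using \<open>\<sigma> > 0\<close> by (intro mult_left_mono) auto
  also have "\<dots> = ((1 + \<sigma>) * u) * G y + (1 + \<sigma> - (1 + \<sigma>) * u) * G (y + \<sigma> + 1)"
    by (simp add: algebra_simps)
  finally have 2: "G (y + \<sigma>) - G y \<le> \<sigma> * (G (y + \<sigma> + 1) - G (y + \<sigma>))"
    unfolding u(1) by (simp add: algebra_simps)
  show "(F y / F (y - 1)) powr \<sigma> \<le> F (y + \<sigma>) / F y"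
    using 1 assms(3,4) by (simp add: F powr_def flip: exp_diff)
  show "F (y + \<sigma>) / F y \<le> (F (y + \<sigma> + 1) / F (y + \<sigma>)) powr \<sigma>"
    using 2 assms(3,4) by (simp add: F powr_def flip: exp_diff)
qed

text \<open>Both \<open>y + 1\<close> and \<open>z\<close> lie between \<open>y\<close> and
  \<open>z + 1\<close>, with exchanged weights. Adding the two convexity inequalities gives G(y+1) +
  G(z) \<le> G(y) + G(z+1), whichever of \<open>y + 1\<close> and \<open>z\<close> is
  larger.\<close>

lemma log_convex_ratio_mono:
  fixes F :: "real \<Rightarrow> real"
  assumes conv: "convex_on {A<..} (\<lambda>y. ln (F y))" and pos: "\<And>y. y > A \<Longrightarrow> F y > 0"
    and "A < y" and "y < z"
  shows "F (y + 1) / F y \<le> F (z + 1) / F z"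
proof -
  define G where "G = (\<lambda>y. ln (F y))"
  have F: "F z = exp (G z)" if "z > A" for z
    using pos[OF that] by (simp add: G_def)
  define t where "t = 1 / (1 + z - y)"
  have t: "0 \<le> t" "t \<le> 1" "t * (1 + z - y) = 1"
    using assms(4) by (auto simp: t_def)
  have "y + 1 = (1 - t) *\<^sub>R y + t *\<^sub>R (z + 1)" "z = (1 - (1 - t)) *\<^sub>R y + (1 - t) *\<^sub>R (z + 1)"
    using t(3) by (auto simp: algebra_simps)
  then have "G (y + 1) \<le> (1 - t) * G y + t * G (z + 1)"
    "G z \<le> (1 - (1 - t)) * G y + (1 - t) * G (z + 1)"
    using convex_onD[OF conv, of t y "z + 1"] convex_onD[OF conv, of "1 - t" y "z + 1"] assms(3,4) t
    by (simp_all add: G_def)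
  then have "G (y + 1) - G y \<le> G (z + 1) - G z"
    by (simp add: algebra_simps)
  then show ?thesis
    using assms(3,4) by (simp add: F flip: exp_diff)
qed

text \<open>The unit ratio increases and is bounded by \<open>M\<close>, hence tends to its supremum
  \<open>D\<close>; any other shift ratio is squeezed between powers of unit ratios.\<close>

lemma log_convex_shift_ratio_tendsto:
  fixes F :: "real \<Rightarrow> real"
  assumes conv: "convex_on {A<..} (\<lambda>y. ln (F y))" and pos: "\<And>y. y > A \<Longrightarrow> F y > 0"
    and bound: "\<And>y. y > A \<Longrightarrow> F (y + 1) \<le> M * F y"
  obtains D where "D > 0" and "\<And>\<sigma>. \<sigma> > 0 \<Longrightarrow> ((\<lambda>y. F (y + \<sigma>) / F y) \<longlongrightarrow> D powr \<sigma>) at_top"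
proof -
  define Q where "Q = (\<lambda>y. F (y + 1) / F y)"
  have Qpos: "Q y > 0" if "y > A" for y
    using pos[of y] pos[of "y + 1"] that by (simp add: Q_def)
  have Qle: "Q y \<le> M" if "y > A" for y
    using bound[OF that] pos[OF that] by (simp add: Q_def divide_le_eq)
  have mono: "Q y \<le> Q z" if "A < y" "y < z" for y z
    using log_convex_ratio_mono[OF conv pos that] by (simp add: Q_def)
  define D where "D = (SUP y\<in>{A<..}. Q y)"
  have bdd: "bdd_above (Q ` {A<..})"
    using Qle by (auto intro!: bdd_aboveI[of _ M])
  have le: "Q y \<le> D" if "y > A" for y
    unfolding D_def using that bdd by (intro cSUP_upper) auto
  have D: "D > 0"
    using Qpos[of "A + 1"] le[of "A + 1"] by simp
  have lim: "(Q \<longlongrightarrow> D) at_top"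
  proof (rule order_tendstoI)
    fix a assume "a < D"
    then obtain y where y: "y > A" "a < Q y"
      unfolding D_def by (subst (asm) less_cSUP_iff[OF _ bdd]) auto
    show "\<forall>\<^sub>F z in at_top. a < Q z"
      using eventually_gt_at_top[of y] by eventually_elim (use y mono in force)
  next
    fix a assume "a > D"
    show "\<forall>\<^sub>F z in at_top. Q z < a"
      using eventually_gt_at_top[of A] by eventually_elim (use \<open>a > D\<close> le in force)
  qed
  have "((\<lambda>y. F (y + \<sigma>) / F y) \<longlongrightarrow> D powr \<sigma>) at_top" if "\<sigma> > 0" for \<sigma>
  proof (rule tendsto_sandwich)
    show "\<forall>\<^sub>F y in at_top. Q (y - 1) powr \<sigma> \<le> F (y + \<sigma>) / F y"
      using eventually_gt_at_top[of "A + 1"]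
      by eventually_elim (use log_convex_ratio_bounds(1)[OF conv pos _ that] in \<open>simp add: Q_def\<close>)
    show "\<forall>\<^sub>F y in at_top. F (y + \<sigma>) / F y \<le> Q (y + \<sigma>) powr \<sigma>"
      using eventually_gt_at_top[of "A + 1"]
      by eventually_elim (use log_convex_ratio_bounds(2)[OF conv pos _ that] in \<open>simp add: Q_def\<close>)
    have "filterlim (\<lambda>y::real. y - 1) at_top at_top" "filterlim (\<lambda>y. y + \<sigma>) at_top at_top"
      by real_asymp+
    then show "((\<lambda>y. Q (y - 1) powr \<sigma>) \<longlongrightarrow> D powr \<sigma>) at_top"
      "((\<lambda>y. Q (y + \<sigma>) powr \<sigma>) \<longlongrightarrow> D powr \<sigma>) at_top"
      using D by (intro tendsto_powr filterlim_compose[OF lim] tendsto_const; simp)+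
  qed
  with D that show thesis by blast
qed

text \<open>As in the Bohr-Mollerup theorem: Gamma is log-convex with unit ratio \<open>y\<close>,
  so its shift ratio lies between \<open>(y - 1) powr \<sigma>\<close> and
  \<open>(y + \<sigma>) powr \<sigma>\<close>.\<close>

lemma Gamma_shift_ratio_tendsto:
  fixes \<sigma> :: real
  assumes "\<sigma> > 0"
  shows "((\<lambda>y. Gamma (y + \<sigma>) / (Gamma y * y powr \<sigma>)) \<longlongrightarrow> 1) at_top"
proof (rule tendsto_sandwich)
  have conv: "convex_on {0<..} (\<lambda>y::real. ln (Gamma y))"
    using log_convex_Gamma_real by (simp add: o_def)
  have step: "Gamma (y + 1) / Gamma y = y" if "y > 0" for y :: real
    using that by (subst Gamma_plus1) (auto elim!: nonpos_Ints_cases' simp: Gamma_eq_zero_iff)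
  show "\<forall>\<^sub>F y in at_top. ((y - 1) / y) powr \<sigma> \<le> Gamma (y + \<sigma>) / (Gamma y * y powr \<sigma>)"
    using eventually_gt_at_top[of 1]
  proof eventually_elim
    case (elim y)
    then have "(y - 1) powr \<sigma> \<le> Gamma (y + \<sigma>) / Gamma y"
      using log_convex_ratio_bounds(1)[OF conv _ _ assms, of y] step[of "y - 1"] by simp
    then show ?case using elim by (simp add: powr_divide field_simps)
  qed
  show "\<forall>\<^sub>F y in at_top. Gamma (y + \<sigma>) / (Gamma y * y powr \<sigma>) \<le> ((y + \<sigma>) / y) powr \<sigma>"
    using eventually_gt_at_top[of 1]
  proof eventually_elim
    case (elim y)
    then have "Gamma (y + \<sigma>) / Gamma y \<le> (y + \<sigma>) powr \<sigma>"
      using log_convex_ratio_bounds(2)[OF conv _ _ assms, of y] step[of "y + \<sigma>"] assms by simp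
    then show ?case using elim assms by (simp add: powr_divide field_simps)
  qed
  have "((\<lambda>y. ((y - 1) / y) powr \<sigma>) \<longlongrightarrow> 1 powr \<sigma>) at_top"
    "((\<lambda>y. ((y + \<sigma>) / y) powr \<sigma>) \<longlongrightarrow> 1 powr \<sigma>) at_top"
    by (intro tendsto_powr tendsto_const; (real_asymp | simp))+
  then show "((\<lambda>y. ((y - 1) / y) powr \<sigma>) \<longlongrightarrow> 1) at_top"
    "((\<lambda>y. ((y + \<sigma>) / y) powr \<sigma>) \<longlongrightarrow> 1) at_top"
    by simp_all
qed

text \<open>Normalising by a power of \<open>y\<close> itself, rather than of
  \<open>c * y + e\<close>, lets the powers of several gamma factors cancel later.\<close>

lemma Gamma_affine_shift_ratio_tendsto:
  fixes \<sigma> c e :: real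
  assumes "\<sigma> > 0" and "c > 0"
  shows "((\<lambda>y. Gamma (c * (y + \<sigma>) + e) / (Gamma (c * y + e) * y powr (c * \<sigma>))) \<longlongrightarrow> c powr (c * \<sigma>)) at_top"
proof -
  have lim: "filterlim (\<lambda>y. c * y + e) at_top at_top"
    using assms(2) by real_asymp
  have "((\<lambda>y. Gamma ((c * y + e) + c * \<sigma>) / (Gamma (c * y + e) * (c * y + e) powr (c * \<sigma>))) \<longlongrightarrow> 1) at_top"
    by (rule filterlim_compose[OF Gamma_shift_ratio_tendsto lim]) (use assms in simp)
  moreover have "((\<lambda>y. ((c * y + e) / y) powr (c * \<sigma>)) \<longlongrightarrow> c powr (c * \<sigma>)) at_top"
    by (intro tendsto_powr tendsto_const; (use assms(2) in real_asymp | use assms(2) in simp))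
  ultimately have "((\<lambda>y. Gamma ((c * y + e) + c * \<sigma>) / (Gamma (c * y + e) * (c * y + e) powr (c * \<sigma>)) *
      ((c * y + e) / y) powr (c * \<sigma>)) \<longlongrightarrow> 1 * c powr (c * \<sigma>)) at_top"
    by (rule tendsto_mult)
  then have "((\<lambda>y. Gamma ((c * y + e) + c * \<sigma>) / (Gamma (c * y + e) * (c * y + e) powr (c * \<sigma>)) *
      ((c * y + e) / y) powr (c * \<sigma>)) \<longlongrightarrow> c powr (c * \<sigma>)) at_top"
    by simp
  moreover have "\<forall>\<^sub>F y in at_top. Gamma ((c * y + e) + c * \<sigma>) / (Gamma (c * y + e) * (c * y + e) powr (c * \<sigma>)) *
      ((c * y + e) / y) powr (c * \<sigma>) = Gamma (c * (y + \<sigma>) + e) / (Gamma (c * y + e) * y powr (c * \<sigma>))"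
    using eventually_gt_at_top[of 0] filterlim_at_top_dense[THEN iffD1, OF lim, rule_format, of 0]
    by eventually_elim (simp add: powr_divide algebra_simps)
  ultimately show ?thesis
    by (rule Lim_transform_eventually)
qed

section \<open>Euler's integral\<close>

lemma binomial_series_pochhammer:
  fixes \<beta> z :: real
  assumes "\<bar>z\<bar> < 1"
  shows "(\<lambda>k. pochhammer \<beta> k / fact k * z ^ k) sums (1 - z) powr (-\<beta>)"
proof -
  have "(- \<beta> gchoose k) * (- z) ^ k = pochhammer \<beta> k / fact k * z ^ k" for k
  proof -
    have "(- 1) ^ k * (- z) ^ k = z ^ k"
      by (simp flip: power_mult_distrib)
    then show ?thesis
      by (simp add: gbinomial_pochhammer mult_ac)
  qed
  then show ?thesis
    using gen_binomial_real[of "-z" "-\<beta>"] assms by simp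
qed

text \<open>These are the moments of the beta weight; they turn binomial coefficients into
  hypergeometric ones in Euler's integral.\<close>

lemma Beta_add_of_nat:
  fixes a b :: real
  assumes "a > 0" "b > 0"
  shows "Beta (a + of_nat k) b = Beta a b * (pochhammer a k / pochhammer (a + b) k)"
proof -
  have "a \<notin> \<int>\<^sub>\<le>\<^sub>0" "a + b \<notin> \<int>\<^sub>\<le>\<^sub>0"
    using assms by (auto elim!: nonpos_Ints_cases')
  moreover have "Gamma (a + b) > 0" "Gamma a > 0" "Gamma (a + of_nat k + b) > 0"
    using assms by (auto intro!: Gamma_real_pos add_pos_nonneg)
  ultimately show ?thesis
    by (simp add: pochhammer_Gamma Beta_def add_ac)
qed

text \<open>Expand \<open>(1 - x * t) powr (-\<beta>)\<close> in its binomial series and integrate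
  term by term against the beta weight. Dominated convergence yields both the integrability and the
  convergence of the hypergeometric series.\<close>

lemma euler_integral:
  fixes \<alpha> \<beta> \<gamma> x :: real
  assumes "0 < \<alpha>" "\<alpha> < \<gamma>" "\<bar>x\<bar> < 1"
  obtains F where
    "(\<lambda>k. (pochhammer \<alpha> k * pochhammer \<beta> k) / (pochhammer \<gamma> k * pochhammer 1 k) * x ^ k) sums F"
    "((\<lambda>t. t powr (\<alpha> - 1) * (1 - t) powr (\<gamma> - \<alpha> - 1) * (1 - x * t) powr (-\<beta>))
       has_integral Beta \<alpha> (\<gamma> - \<alpha>) * F) {0..1}"
proof -
  define K where "K = (\<lambda>t. t powr (\<alpha> - 1) * (1 - t) powr (\<gamma> - \<alpha> - 1))"
  define c where "c = (\<lambda>k. pochhammer \<beta> k / fact k)"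
  define B where "B = Beta \<alpha> (\<gamma> - \<alpha>)"
  have "B > 0"
    using assms by (auto simp: B_def Beta_def)
  \<comment> \<open>Convergence at \<open>(1 + \<bar>x\<bar>) / 2\<close>, strictly between
    \<open>\<bar>x\<bar>\<close> and 1, gives absolute convergence at \<open>x\<close>.\<close>
  have summ: "summable (\<lambda>k. norm (c k * x ^ k))"
  proof (rule powser_insidea)
    show "summable (\<lambda>k. c k * ((1 + \<bar>x\<bar>) / 2) ^ k)"
      using binomial_series_pochhammer[of "(1 + \<bar>x\<bar>) / 2" \<beta>] assms(3)
      by (auto simp: c_def sums_iff)
  qed (use assms(3) in auto)
  define M where "M = (\<Sum>k. norm (c k * x ^ k))"
  define f where "f = (\<lambda>k t. K t * (\<Sum>j<k. c j * (x * t) ^ j))"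
  define cf where "cf = (\<lambda>j. (pochhammer \<alpha> j * pochhammer \<beta> j) / (pochhammer \<gamma> j * pochhammer 1 j) * x ^ j)"
  have fint: "(f k has_integral B * (\<Sum>j<k. cf j)) {0..1}" for k
  proof -
    have "((\<lambda>t. \<Sum>j<k. (c j * x ^ j) * (t powr (\<alpha> + of_nat j - 1) * (1 - t) powr (\<gamma> - \<alpha> - 1)))
        has_integral (\<Sum>j<k. (c j * x ^ j) * Beta (\<alpha> + of_nat j) (\<gamma> - \<alpha>))) {0..1}"
      using assms by (intro has_integral_sum has_integral_mult_right has_integral_Beta_real) auto
    also have "(\<Sum>j<k. (c j * x ^ j) * Beta (\<alpha> + of_nat j) (\<gamma> - \<alpha>)) = B * (\<Sum>j<k. cf j)"
      using assms by (simp add: Beta_add_of_nat sum_distrib_left c_def cf_def B_def pochhammer_fact mult_ac)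
    finally show ?thesis
    proof (rule has_integral_eq[rotated])
      fix t :: real assume "t \<in> {0..1}"
      \<comment> \<open>At \<open>t = 0\<close> both sides are 0, since \<open>0 powr e = 0\<close>
        for every exponent.\<close>
      have "t powr (\<alpha> + of_nat j - 1) = t powr (\<alpha> - 1) * t ^ j" for j
      proof (cases "t = 0")
        case False
        then have "t > 0" using \<open>t \<in> {0..1}\<close> by auto
        then show ?thesis
          by (simp add: powr_add[symmetric] powr_realpow[symmetric] algebra_simps)
      qed simp
      then show "(\<Sum>j<k. c j * x ^ j * (t powr (\<alpha> + real j - 1) * (1 - t) powr (\<gamma> - \<alpha> - 1))) = f k t"
        by (simp add: f_def K_def sum_distrib_left power_mult_distrib mult_ac)
    qed
  qed
  have K: "K integrable_on {0..1}" "K t \<ge> 0" for t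
    using has_integral_Beta_real[of \<alpha> "\<gamma> - \<alpha>"] assms by (auto simp: K_def)
  \<comment> \<open>On [0, 1] the factors \<open>t ^ j\<close> only shrink the terms, so the
    absolute sum at \<open>t = 1\<close> dominates all partial sums.\<close>
  have le: "norm (f k t) \<le> K t * M" if "t \<in> {0..1}" for k t
  proof -
    have "norm (\<Sum>j<k. c j * (x * t) ^ j) \<le> (\<Sum>j<k. norm (c j * x ^ j))"
    proof (rule sum_norm_le)
      fix j
      have "norm (c j * (x * t) ^ j) = norm (c j * x ^ j) * t ^ j"
        using that by (simp add: abs_mult power_mult_distrib power_abs)
      also have "\<dots> \<le> norm (c j * x ^ j) * 1"
        using that by (intro mult_left_mono power_le_one) auto
      finally show "norm (c j * (x * t) ^ j) \<le> norm (c j * x ^ j)" by simp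
    qed
    also have "\<dots> \<le> M"
      unfolding M_def by (rule sum_le_suminf[OF summ]) auto
    finally show ?thesis
      using K(2)[of t] by (simp add: f_def abs_mult mult_left_mono)
  qed
  have lim: "(\<lambda>k. f k t) \<longlonglongrightarrow> K t * (1 - x * t) powr (-\<beta>)" if "t \<in> {0..1}" for t
  proof -
    have "\<bar>x\<bar> * \<bar>t\<bar> \<le> \<bar>x\<bar> * 1"
      using that by (intro mult_left_mono) auto
    then have "\<bar>x * t\<bar> < 1"
      using assms(3) by (simp add: abs_mult)
    then show ?thesis
      unfolding f_def c_def using binomial_series_pochhammer[of "x * t" \<beta>]
      by (intro tendsto_mult_left) (simp add: sums_def)
  qed
  have int: "(\<lambda>t. K t * M) integrable_on {0..1}"
    by (intro integrable_on_mult_left K)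
  have fint': "f k integrable_on {0..1}" for k
    using fint[of k] by blast
  note dc = dominated_convergence[OF fint' int le lim, simplified]
  define J where "J = integral {0..1} (\<lambda>t. K t * (1 - x * t) powr (-\<beta>))"
  have "(\<lambda>k. B * (\<Sum>j<k. cf j)) \<longlonglongrightarrow> J"
    using dc(2) integral_unique[OF fint] by (simp add: J_def)
  then have "(\<lambda>k. (B * (\<Sum>j<k. cf j)) / B) \<longlonglongrightarrow> J / B"
    using \<open>B > 0\<close> by (intro tendsto_divide tendsto_const) auto
  then have "cf sums (J / B)"
    using \<open>B > 0\<close> by (simp add: sums_def)
  moreover have "((\<lambda>t. K t * (1 - x * t) powr (-\<beta>)) has_integral B * (J / B)) {0..1}"
    using dc(1) \<open>B > 0\<close> by (simp add: J_def has_integral_integral)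
  ultimately show thesis
    using that[of "J / B"] by (simp add: cf_def K_def B_def)
qed

text \<open>Compactness of [0, 1]. The lower bound will keep Euler's integral positive, the upper
  bound will limit its growth under a unit shift.\<close>

lemma powr_one_minus_mult_bounds:
  fixes x e :: real
  assumes "\<bar>x\<bar> < 1"
  obtains c C where "0 < c" "\<forall>t\<in>{0..1}. c \<le> (1 - x * t) powr e \<and> (1 - x * t) powr e \<le> C"
proof -
  have pos: "1 - x * t > 0" if "t \<in> {0..1}" for t
  proof -
    have "\<bar>x\<bar> * \<bar>t\<bar> \<le> \<bar>x\<bar> * 1"
      using that by (intro mult_left_mono) auto
    then have "\<bar>x * t\<bar> < 1"
      using assms by (simp add: abs_mult)
    then show ?thesis by simp
  qed
  have cont: "continuous_on {0..1} (\<lambda>t. (1 - x * t) powr e)"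
    by (intro continuous_intros) (use pos in force)
  obtain t1 where t1: "t1 \<in> {0..1}" "\<forall>t\<in>{0..1}. (1 - x * t1) powr e \<le> (1 - x * t) powr e"
    using continuous_attains_inf[OF compact_Icc _ cont] by force
  obtain t2 where t2: "\<forall>t\<in>{0..1}. (1 - x * t) powr e \<le> (1 - x * t2) powr e"
    using continuous_attains_sup[OF compact_Icc _ cont] by force
  have "0 < (1 - x * t1) powr e"
    using pos[OF t1(1)] by simp
  then show thesis
    by (rule that) (use t1(2) t2 in blast)
qed

text \<open>Hoelder's inequality: the integrand is the exponential of an affine function of
  \<open>s\<close>, so at an intermediate parameter it is a weighted geometric mean of the two outer
  integrands. Off \<open>T\<close> it vanishes.\<close>

lemma log_convex_integral_exp:
  fixes L0 L1 :: "real \<Rightarrow> real" and J :: "real \<Rightarrow> real \<Rightarrow> real"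
  assumes J: "\<And>s t. s > A \<Longrightarrow> t \<in> S \<Longrightarrow> J s t = (if t \<in> T then exp (L0 t + s * L1 t) else 0)"
    and I: "\<And>s. s > A \<Longrightarrow> (J s has_integral I s) S" and pos: "\<And>s. s > A \<Longrightarrow> I s > 0"
  shows "convex_on {A<..} (\<lambda>s. ln (I s))"
proof (rule convex_onI)
  fix \<theta> s u :: real
  assume *: "0 < \<theta>" "\<theta> < 1" "s \<in> {A<..}" "u \<in> {A<..}"
  define z where "z = (1 - \<theta>) *\<^sub>R s + \<theta> *\<^sub>R u"
  have "z \<in> {A<..}"
    unfolding z_def using * by (intro convexD_alt) auto
  then have "z > A" by simp
  \<comment> \<open>Division by the integrals \<open>I s\<close>, \<open>I u\<close> and their
    geometric mean \<open>g\<close> reduces the claim to Young's inequality, applied pointwise and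
    integrated.\<close>
  define g where "g = I s powr (1 - \<theta>) * I u powr \<theta>"
  have Ipos: "I s > 0" "I u > 0"
    using pos * by auto
  then have "g > 0"
    by (simp add: g_def)
  have le: "J z t / g \<le> (1 - \<theta>) * (J s t / I s) + \<theta> * (J u t / I u)" if "t \<in> S" for t
  proof (cases "t \<in> T")
    case True
    define a where "a = exp (L0 t + s * L1 t)"
    define b where "b = exp (L0 t + u * L1 t)"
    have "exp (L0 t + z * L1 t) = a powr (1 - \<theta>) * b powr \<theta>"
      by (simp add: a_def b_def powr_def z_def algebra_simps flip: exp_add)
    then have "J z t / g = (a / I s) powr (1 - \<theta>) * (b / I u) powr \<theta>"
      using J[OF \<open>z > A\<close> that] True Ipos by (simp add: g_def powr_divide a_def b_def)
    also have "\<dots> \<le> (1 - \<theta>) * (a / I s) + \<theta> * (b / I u)"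
      using Ipos * by (intro Youngs_inequality_0) (auto simp: a_def b_def)
    finally show ?thesis
      using J[of s t] J[of u t] * that True by (simp add: a_def b_def)
  next
    case False
    then show ?thesis using J that \<open>z > A\<close> * by simp
  qed
  have "I z / g \<le> (1 - \<theta>) * (I s / I s) + \<theta> * (I u / I u)"
  proof (rule has_integral_le[OF _ _ le])
    show "((\<lambda>t. J z t / g) has_integral I z / g) S"
      using I \<open>z > A\<close> by (intro has_integral_divide) auto
    show "((\<lambda>t. (1 - \<theta>) * (J s t / I s) + \<theta> * (J u t / I u)) has_integral
        (1 - \<theta>) * (I s / I s) + \<theta> * (I u / I u)) S"
      using I * by (intro has_integral_add has_integral_mult_right has_integral_divide) auto
  qed
  then have "I z \<le> g"
    using Ipos \<open>g > 0\<close> by (simp add: divide_le_eq)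
  then have "ln (I z) \<le> ln g"
    using pos[OF \<open>z > A\<close>] by (simp add: ln_mono)
  then show "ln (I ((1 - \<theta>) *\<^sub>R s + \<theta> *\<^sub>R u)) \<le> (1 - \<theta>) * ln (I s) + \<theta> * ln (I u)"
    using Ipos by (simp add: g_def z_def ln_mult ln_powr)
qed auto

section \<open>Shift ratios of the hypergeometric function on a real half-line\<close>

lemma hyp2F1_of_real:
  fixes \<alpha> \<beta> \<gamma> x :: real
  assumes "(\<lambda>k. (pochhammer \<alpha> k * pochhammer \<beta> k) / (pochhammer \<gamma> k * pochhammer 1 k) * x ^ k) sums F"
  shows "hyp2F1 (of_real \<alpha>) (of_real \<beta>) (of_real \<gamma>) (of_real x) = of_real F"
proof -
  have "(\<lambda>k. complex_of_real ((pochhammer \<alpha> k * pochhammer \<beta> k) / (pochhammer \<gamma> k * pochhammer 1 k) * x ^ k)) sums of_real F"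
    using assms by (rule sums_of_real)
  moreover have "pochhammer 1 k = complex_of_real (pochhammer 1 k)" for k
    using pochhammer_of_real[of 1 k, where 'a = complex] by simp
  ultimately show ?thesis
    unfolding hyp2F1_def by (simp add: sums_iff pochhammer_of_real)
qed

text \<open>The integrand is h(t) E(t)^s with E(t) = t^p (1-t)^(r-p) (1-xt)^(-q). This form makes
  \<open>I\<close> log-convex, and a bound \<open>M\<close> for E gives I(s+1) \<le> M I(s).\<close>

lemma euler_integral_shift_ratio:
  fixes p q r a b x :: real
  assumes "0 < p" "p < r" "\<bar>x\<bar> < 1"
  obtains A D and I F :: "real \<Rightarrow> real" where
    "D > 0" "\<forall>s>A. p * s + a > 0 \<and> (r - p) * s - a > 0 \<and> I s > 0"
    "\<forall>s>A. I s = Beta (p * s + a) ((r - p) * s - a) * F s"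
    "\<forall>s>A. hgf p q r a b x (of_real s) = of_real (F s)"
    "\<forall>\<sigma>>0. ((\<lambda>y. I (y + \<sigma>) / I y) \<longlongrightarrow> D powr \<sigma>) at_top"
proof -
  define A where "A = max (- a / p) (a / (r - p))"
  have A: "p * s + a > 0" "(r - p) * s - a > 0" if "s > A" for s
    using that assms by (auto simp: A_def field_simps)
  define J where "J = (\<lambda>s t. t powr (p * s + a - 1) * (1 - t) powr ((r - p) * s - a - 1) * (1 - x * t) powr (-(q * s + b)))"
  have "\<exists>F. (J s has_integral Beta (p * s + a) ((r - p) * s - a) * F) {0..1} \<and>
      hgf p q r a b x (of_real s) = of_real F" if "s > A" for s
  proof -
    have "0 < p * s + a" "p * s + a < r * s"
      using A[OF that] by (auto simp: algebra_simps)
    from euler_integral[OF this assms(3), of "q * s + b"] obtain F where F: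
      "(\<lambda>k. (pochhammer (p * s + a) k * pochhammer (q * s + b) k) / (pochhammer (r * s) k * pochhammer 1 k) * x ^ k) sums F"
      "((\<lambda>t. t powr (p * s + a - 1) * (1 - t) powr (r * s - (p * s + a) - 1) * (1 - x * t) powr (-(q * s + b)))
       has_integral Beta (p * s + a) (r * s - (p * s + a)) * F) {0..1}" .
    have eq: "r * s - (p * s + a) = (r - p) * s - a"
      by (simp add: algebra_simps)
    show ?thesis
      using F(2) hyp2F1_of_real[OF F(1)] unfolding eq
      by (intro exI[of _ F]) (simp add: hgf_def J_def)
  qed
  then obtain F where F: "\<And>s. s > A \<Longrightarrow> (J s has_integral Beta (p * s + a) ((r - p) * s - a) * F s) {0..1}"
      "\<And>s. s > A \<Longrightarrow> hgf p q r a b x (of_real s) = of_real (F s)"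
    by metis
  define I where "I = (\<lambda>s. Beta (p * s + a) ((r - p) * s - a) * F s)"
  have Ipos: "I s > 0" if "s > A" for s
  proof -
    obtain c C where c: "0 < c" "\<forall>t\<in>{0..1}. c \<le> (1 - x * t) powr (-(q * s + b)) \<and> (1 - x * t) powr (-(q * s + b)) \<le> C"
      using powr_one_minus_mult_bounds[OF assms(3), of "-(q * s + b)"] by blast
    \<comment> \<open>Replacing the third factor by its lower bound \<open>c\<close> leaves
      \<open>c\<close> times a beta integral, which is positive.\<close>
    have "Beta (p * s + a) ((r - p) * s - a) * c \<le> I s"
    proof (rule has_integral_le)
      show "((\<lambda>t. t powr (p * s + a - 1) * (1 - t) powr ((r - p) * s - a - 1) * c) has_integral
        Beta (p * s + a) ((r - p) * s - a) * c) {0..1}"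
        by (rule has_integral_mult_left[OF has_integral_Beta_real]) (use A[OF that] in auto)
      show "(J s has_integral I s) {0..1}"
        unfolding I_def by (rule F(1)[OF that])
      fix t :: real assume "t \<in> {0..1}"
      then show "t powr (p * s + a - 1) * (1 - t) powr ((r - p) * s - a - 1) * c \<le> J s t"
        unfolding J_def using c(2) by (intro mult_left_mono) auto
    qed
    moreover have "Beta (p * s + a) ((r - p) * s - a) > 0"
      using A[OF that] unfolding Beta_def by (intro divide_pos_pos mult_pos_pos Gamma_real_pos) auto
    ultimately show ?thesis
      using c(1) by (meson less_le_trans mult_pos_pos)
  qed
  obtain c M where M: "\<forall>t\<in>{0..1}. c \<le> (1 - x * t) powr (-q) \<and> (1 - x * t) powr (-q) \<le> M"
    using powr_one_minus_mult_bounds[OF assms(3), of "-q"] by blast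
  have bound: "I (s + 1) \<le> M * I s" if "s > A" for s
  proof (rule has_integral_le)
    show "(J (s + 1) has_integral I (s + 1)) {0..1}"
      unfolding I_def using that by (intro F(1)) auto
    show "((\<lambda>t. M * J s t) has_integral M * I s) {0..1}"
      unfolding I_def by (rule has_integral_mult_right[OF F(1)[OF that]])
    fix t :: real assume t: "t \<in> {0..1}"
    \<comment> \<open>This is E(t) \<le> M; multiplication by E(t) turns \<open>J s t\<close> into
      \<open>J (s + 1) t\<close>.\<close>
    have "t powr p * (1 - t) powr (r - p) * (1 - x * t) powr (-q) \<le> 1 * 1 * M"
      using t M assms by (intro mult_mono powr_le1) auto
    then have "J s t * (t powr p * (1 - t) powr (r - p) * (1 - x * t) powr (-q)) \<le> J s t * M"
      by (intro mult_left_mono) (auto simp: J_def)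
    also have "J s t * (t powr p * (1 - t) powr (r - p) * (1 - x * t) powr (-q)) =
        (t powr (p * s + a - 1) * t powr p) * ((1 - t) powr ((r - p) * s - a - 1) * (1 - t) powr (r - p)) *
        ((1 - x * t) powr (-(q * s + b)) * (1 - x * t) powr (-q))"
      by (simp add: J_def mult_ac)
    also have "\<dots> = J (s + 1) t"
      unfolding powr_add[symmetric] J_def by (simp add: algebra_simps)
    finally show "J (s + 1) t \<le> M * J s t"
      by (simp add: mult.commute)
  qed
  have conv: "convex_on {A<..} (\<lambda>s. ln (I s))"
  proof (rule log_convex_integral_exp)
    show "(J s has_integral I s) {0..1}" if "s > A" for s
      unfolding I_def using that by (intro F(1)) auto
    fix s t :: real assume *: "s > A" "t \<in> {0..1}"
    \<comment> \<open>At both endpoints \<open>J s t\<close> is 0 by the convention for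
      \<open>0 powr\<close>, so the exponential form lives on the open interval.\<close>
    show "J s t = (if t \<in> {0<..<1} then
       exp (((a - 1) * ln t + (- a - 1) * ln (1 - t) - b * ln (1 - x * t)) +
         s * (p * ln t + (r - p) * ln (1 - t) - q * ln (1 - x * t))) else 0)"
    proof (cases "t \<in> {0<..<1}")
      case True
      have "\<bar>x\<bar> * \<bar>t\<bar> \<le> \<bar>x\<bar> * 1"
        using True by (intro mult_left_mono) auto
      then have "\<bar>x * t\<bar> < 1"
        using assms by (simp add: abs_mult)
      then have "1 - x * t \<noteq> 0" by simp
      with True show ?thesis
        by (simp add: J_def powr_def algebra_simps flip: exp_add)
    next
      case False
      then have "t = 0 \<or> t = 1" using * by auto
      with False show ?thesis by (auto simp: J_def)
    qed
  qed (use Ipos in auto)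
  obtain D where "D > 0" "\<And>\<sigma>. \<sigma> > 0 \<Longrightarrow> ((\<lambda>y. I (y + \<sigma>) / I y) \<longlongrightarrow> D powr \<sigma>) at_top"
    using log_convex_shift_ratio_tendsto[OF conv Ipos bound] by blast
  with A Ipos F(2) show thesis
    by (intro that[of D A I F]) (auto simp: I_def)
qed

text \<open>Here \<open>F\<close> is \<open>I\<close> times Gamma(rs) over Gamma(ps+a)
  Gamma((r-p)s-a). The powers of \<open>y\<close> in the gamma shift ratios cancel because p + (r-p)
  = r, leaving constants only.\<close>

lemma hgf_real_shift_ratio:
  fixes p q r a b x :: real
  assumes "0 < p" "p < r" "\<bar>x\<bar> < 1"
  obtains A D and F :: "real \<Rightarrow> real" where
    "D > 0" "\<forall>s>A. F s > 0"
    "\<forall>s>A. hgf p q r a b x (of_real s) = of_real (F s)"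
    "\<forall>\<sigma>>0. ((\<lambda>y. F (y + \<sigma>) / F y) \<longlongrightarrow> D powr \<sigma>) at_top"
proof -
  obtain A D I F where D: "D > 0" and A: "\<forall>s>A. p * s + a > 0 \<and> (r - p) * s - a > 0 \<and> I s > 0"
    and IF: "\<forall>s>A. I s = Beta (p * s + a) ((r - p) * s - a) * F s"
    and F: "\<forall>s>A. hgf p q r a b x (of_real s) = of_real (F s)"
    and lim: "\<forall>\<sigma>>0. ((\<lambda>y. I (y + \<sigma>) / I y) \<longlongrightarrow> D powr \<sigma>) at_top"
    by (rule euler_integral_shift_ratio[OF assms, of a q b]) (rule that)
  note A = A[rule_format] and IF = IF[rule_format] and lim = lim[rule_format]
  define P where "P = (\<lambda>s. Gamma (p * s + a))"
  define Q where "Q = (\<lambda>s. Gamma ((r - p) * s + (-a)))"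
  define R where "R = (\<lambda>s. Gamma (r * s + 0))"
  have pos: "P s > 0" "Q s > 0" "R s > 0" if "s > A" for s
  proof -
    have "r * s = (p * s + a) + ((r - p) * s - a)" by (simp add: algebra_simps)
    then have "r * s > 0" using A[OF that] by simp
    then show "P s > 0" "Q s > 0" "R s > 0"
      using A[OF that] by (auto simp: P_def Q_def R_def)
  qed
  have Feq: "F s = I s * R s / (P s * Q s)" if "s > A" for s
  proof -
    have "(p * s + a) + ((r - p) * s - a) = r * s" by (simp add: algebra_simps)
    then have "I s = P s * Q s / R s * F s"
      using IF[OF that] by (simp add: Beta_def P_def Q_def R_def)
    then show ?thesis using pos[OF that] by (simp add: field_simps)
  qed
  have Fpos: "F s > 0" if "s > A" for s
    using Feq[OF that] pos[OF that] A[OF that] by simp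
  \<comment> \<open>The factors of type \<open>c powr c\<close> come from the affine gamma limits
    with \<open>c\<close> equal to \<open>r\<close>, \<open>p\<close> and
    \<open>r - p\<close>.\<close>
  define E where "E = D * (r powr r / (p powr p * (r - p) powr (r - p)))"
  have "E > 0" using D assms by (simp add: E_def)
  have "((\<lambda>y. F (y + \<sigma>) / F y) \<longlongrightarrow> E powr \<sigma>) at_top" if "\<sigma> > 0" for \<sigma>
  proof -
    have "((\<lambda>y. (I (y + \<sigma>) / I y) *
        ((R (y + \<sigma>) / (R y * y powr (r * \<sigma>))) /
        ((P (y + \<sigma>) / (P y * y powr (p * \<sigma>))) * (Q (y + \<sigma>) / (Q y * y powr ((r - p) * \<sigma>))))))
      \<longlongrightarrow> D powr \<sigma> * (r powr (r * \<sigma>) / (p powr (p * \<sigma>) * (r - p) powr ((r - p) * \<sigma>)))) at_top"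
      unfolding P_def Q_def R_def using assms that
      by (intro tendsto_mult tendsto_divide lim Gamma_affine_shift_ratio_tendsto) auto
    also have "D powr \<sigma> * (r powr (r * \<sigma>) / (p powr (p * \<sigma>) * (r - p) powr ((r - p) * \<sigma>))) = E powr \<sigma>"
      using assms D by (simp add: E_def powr_mult powr_divide powr_powr)
    finally show ?thesis
    proof (rule Lim_transform_eventually)
      show "\<forall>\<^sub>F y in at_top. (I (y + \<sigma>) / I y) *
        ((R (y + \<sigma>) / (R y * y powr (r * \<sigma>))) /
        ((P (y + \<sigma>) / (P y * y powr (p * \<sigma>))) * (Q (y + \<sigma>) / (Q y * y powr ((r - p) * \<sigma>)))))
        = F (y + \<sigma>) / F y"
        using eventually_gt_at_top[of A] eventually_gt_at_top[of 0]
      proof eventually_elim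
        case (elim y)
        have "y powr (r * \<sigma>) = y powr (p * \<sigma>) * y powr ((r - p) * \<sigma>)"
          by (simp add: algebra_simps flip: powr_add)
        moreover have "F (y + \<sigma>) / F y =
            (I (y + \<sigma>) * R (y + \<sigma>) / (P (y + \<sigma>) * Q (y + \<sigma>))) / (I y * R y / (P y * Q y))"
          using elim that Feq[of y] Feq[of "y + \<sigma>"] by simp
        moreover have "P y \<noteq> 0" "Q y \<noteq> 0" "R y \<noteq> 0" "I y \<noteq> 0" "P (y + \<sigma>) \<noteq> 0" "Q (y + \<sigma>) \<noteq> 0"
          "y powr (p * \<sigma>) \<noteq> 0" "y powr ((r - p) * \<sigma>) \<noteq> 0"
          using elim that pos[of y] pos[of "y + \<sigma>"] A[of y] by auto
        ultimately show ?case
          by (simp add: field_simps)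
      qed
    qed
  qed
  with \<open>E > 0\<close> Fpos F show thesis
    by (intro that[of E A F]) auto
qed

section \<open>The regularised hypergeometric series\<close>

text \<open>This is the series of 2F1 divided by Gamma(\<gamma>). As \<open>rGamma\<close> is
  entire, each term is entire in all three parameters, so no value of \<gamma> is
  exceptional.\<close>

definition hyp2F1_reg :: "complex \<Rightarrow> complex \<Rightarrow> complex \<Rightarrow> complex \<Rightarrow> complex" where
  "hyp2F1_reg \<alpha> \<beta> \<gamma> z =
     (\<Sum>k. pochhammer \<alpha> k * pochhammer \<beta> k * rGamma (\<gamma> + of_nat k) / fact k * z ^ k)"

lemma norm_pochhammer_le:
  fixes \<alpha> :: complex
  assumes "norm \<alpha> \<le> N"
  shows "norm (pochhammer \<alpha> k) \<le> pochhammer N k"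
proof (induction k)
  case (Suc k)
  have "norm (\<alpha> + of_nat k) \<le> N + of_nat k"
    using assms norm_triangle_ineq[of \<alpha> "of_nat k"] by simp
  with Suc have "norm (pochhammer \<alpha> k) * norm (\<alpha> + of_nat k) \<le> pochhammer N k * (N + of_nat k)"
    by (intro mult_mono) (use assms in \<open>auto intro: order.trans[OF norm_ge_zero]\<close>)
  then show ?case by (simp add: pochhammer_Suc norm_mult)
qed simp

text \<open>After \<open>N + 1\<close> unit steps the argument \<open>w\<close> has modulus at most
  \<open>2 * N + 1\<close>, and each further factor \<open>w + i\<close> has modulus at least
  \<open>1 + i\<close>. Dividing \<open>rGamma w\<close> by these factors produces the
  factorial.\<close>

lemma norm_rGamma_add_of_nat_le:
  fixes \<gamma> :: complex
  assumes "\<And>w :: complex. norm w \<le> real (2 * N + 1) \<Longrightarrow> norm (rGamma w) \<le> B" and "norm \<gamma> \<le> real N" and "k \<ge> N + 1"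
  shows "norm (rGamma (\<gamma> + of_nat k)) \<le> B / fact (k - (N + 1))"
proof -
  define j where "j = k - (N + 1)"
  define w where "w = \<gamma> + of_nat (N + 1)"
  have k: "\<gamma> + of_nat k = w + of_nat j"
    using assms(3) by (simp add: w_def j_def of_nat_diff)
  have le: "1 + real i \<le> norm (w + of_nat i)" for i
  proof -
    have "real (N + 1 + i) - norm \<gamma> = norm (of_nat (N + 1 + i) :: complex) - norm (- \<gamma>)"
      by (simp only: norm_of_nat norm_minus_cancel)
    also have "\<dots> \<le> norm (of_nat (N + 1 + i) - (- \<gamma>))"
      by (rule norm_triangle_ineq2)
    also have "of_nat (N + 1 + i) - (- \<gamma>) = w + of_nat i"
      by (simp add: w_def)
    finally show ?thesis using assms(2) by simp
  qed
  have "pochhammer 1 j \<le> norm (pochhammer w j)"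
  proof (induction j)
    case (Suc j)
    have "pochhammer 1 j * (1 + real j) \<le> norm (pochhammer w j) * norm (w + of_nat j)"
      using Suc le[of j] by (intro mult_mono) auto
    then show ?case by (simp add: pochhammer_Suc norm_mult)
  qed simp
  then have "fact j * norm (rGamma (w + of_nat j)) \<le> norm (pochhammer w j) * norm (rGamma (w + of_nat j))"
    by (intro mult_right_mono) (auto simp: pochhammer_fact)
  also have "\<dots> = norm (rGamma w)"
    by (metis norm_mult pochhammer_rGamma)
  also have "\<dots> \<le> B"
  proof (rule assms(1))
    show "norm w \<le> real (2 * N + 1)"
      using norm_triangle_ineq[of \<gamma> "of_nat (N + 1)"] assms(2) unfolding w_def norm_of_nat by simp
  qed
  finally show ?thesis
    by (simp add: k j_def field_simps)
qed

text \<open>From \<open>K\<close> on, the truncated difference \<open>k - K\<close> is genuine and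
  the quotient of successive terms is \<open>g k\<close>, which tends to
  \<open>x < 1\<close>.\<close>

lemma hyp2F1_reg_majorant_summable:
  fixes N x B :: real
  assumes "0 \<le> N" "0 \<le> x" "x < 1"
  shows "summable (\<lambda>k. pochhammer N k * pochhammer N k * (B / fact (k - K)) / fact k * x ^ k)"
proof -
  define f where "f = (\<lambda>k. pochhammer N k * pochhammer N k * (B / fact (k - K)) / fact k * x ^ k)"
  define g where "g = (\<lambda>k::nat. (N + real k)\<^sup>2 * x / ((real k - real K + 1) * (real k + 1)))"
  define c where "c = (1 + x) / 2"
  have c: "x < c" "c < 1" using assms by (auto simp: c_def)
  have "g \<longlonglongrightarrow> x"
    unfolding g_def by real_asymp
  then have "\<forall>\<^sub>F k in sequentially. g k < c"
    using c(1) by (rule order_tendstoD)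
  then obtain L where L: "\<And>k. k \<ge> L \<Longrightarrow> g k < c"
    by (auto simp: eventually_at_top_linorder)
  have "summable f"
  proof (rule summable_ratio_test[OF c(2)])
    fix k assume "k \<ge> max L K"
    then have k: "k \<ge> L" "k \<ge> K" by auto
    have "f (Suc k) = f k * g k"
      using k(2) by (simp add: f_def g_def pochhammer_Suc Suc_diff_le of_nat_diff power2_eq_square field_simps)
    moreover have "g k \<ge> 0"
      using k(2) assms by (simp add: g_def)
    ultimately have "norm (f (Suc k)) = g k * norm (f k)"
      by (simp add: abs_mult mult.commute)
    also have "\<dots> \<le> c * norm (f k)"
      using L[OF k(1)] by (intro mult_right_mono) auto
    finally show "norm (f (Suc k)) \<le> c * norm (f k)" .
  qed
  then show ?thesis by (simp add: f_def)
qed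

text \<open>Compactness bounds \<open>rGamma\<close> on the disc of radius \<open>2 * N + 1\<close>,
  which feeds the factorial decay estimate. The majorant depends on the parameters only through
  \<open>N\<close>, as locally uniform convergence requires.\<close>

lemma hyp2F1_reg_majorant:
  fixes z :: complex
  assumes "norm z < 1"
  obtains M where "summable M"
    "\<forall>k\<ge>N + 1. \<forall>\<alpha> \<beta> \<gamma>. norm \<alpha> \<le> real N \<longrightarrow> norm \<beta> \<le> real N \<longrightarrow> norm \<gamma> \<le> real N \<longrightarrow>
       norm (pochhammer \<alpha> k * pochhammer \<beta> k * rGamma (\<gamma> + of_nat k) / fact k * z ^ k) \<le> M k"
proof -
  have "compact (rGamma ` cball (0::complex) (real (2 * N + 1)))"
    by (intro compact_continuous_image continuous_on_rGamma compact_cball)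
  then obtain B where "\<forall>w\<in>rGamma ` cball (0::complex) (real (2 * N + 1)). norm w \<le> B"
    using compact_imp_bounded bounded_iff by metis
  then have B: "norm (rGamma w) \<le> B" if "norm w \<le> real (2 * N + 1)" for w :: complex
    using that by auto
  show thesis
  proof (rule that)
    show "summable (\<lambda>k. pochhammer (real N) k * pochhammer (real N) k * (B / fact (k - (N + 1))) / fact k * norm z ^ k)"
      using assms by (intro hyp2F1_reg_majorant_summable) auto
    show "\<forall>k\<ge>N + 1. \<forall>\<alpha> \<beta> \<gamma>. norm \<alpha> \<le> real N \<longrightarrow> norm \<beta> \<le> real N \<longrightarrow> norm \<gamma> \<le> real N \<longrightarrow>
       norm (pochhammer \<alpha> k * pochhammer \<beta> k * rGamma (\<gamma> + of_nat k) / fact k * z ^ k)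
       \<le> pochhammer (real N) k * pochhammer (real N) k * (B / fact (k - (N + 1))) / fact k * norm z ^ k"
    proof (intro allI impI)
      fix k and \<alpha> \<beta> \<gamma> :: complex
      assume *: "k \<ge> N + 1" "norm \<alpha> \<le> real N" "norm \<beta> \<le> real N" "norm \<gamma> \<le> real N"
      have "0 \<le> pochhammer (real N) k"
        by (simp add: pochhammer_prod prod_nonneg)
      then have "norm (pochhammer \<alpha> k) * norm (pochhammer \<beta> k) * norm (rGamma (\<gamma> + of_nat k))
        \<le> pochhammer (real N) k * pochhammer (real N) k * (B / fact (k - (N + 1)))"
        using * B by (intro mult_mono norm_pochhammer_le norm_rGamma_add_of_nat_le mult_nonneg_nonneg) auto
      then show "norm (pochhammer \<alpha> k * pochhammer \<beta> k * rGamma (\<gamma> + of_nat k) / fact k * z ^ k)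
       \<le> pochhammer (real N) k * pochhammer (real N) k * (B / fact (k - (N + 1))) / fact k * norm z ^ k"
        unfolding norm_mult norm_divide norm_power norm_fact
        by (intro mult_right_mono divide_right_mono) auto
    qed
  qed
qed

lemma hyp2F1_reg_uniform_limit:
  fixes z :: complex
  assumes "norm z < 1" and "\<And>w. w \<in> X \<Longrightarrow> norm (f w) \<le> real N \<and> norm (g w) \<le> real N \<and> norm (h w) \<le> real N"
  shows "uniform_limit X (\<lambda>n w. \<Sum>k<n. pochhammer (f w) k * pochhammer (g w) k * rGamma (h w + of_nat k) / fact k * z ^ k)
    (\<lambda>w. hyp2F1_reg (f w) (g w) (h w) z) sequentially"
proof -
  obtain M where M: "summable M"
    "\<forall>k\<ge>N + 1. \<forall>\<alpha> \<beta> \<gamma>. norm \<alpha> \<le> real N \<longrightarrow> norm \<beta> \<le> real N \<longrightarrow> norm \<gamma> \<le> real N \<longrightarrow>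
       norm (pochhammer \<alpha> k * pochhammer \<beta> k * rGamma (\<gamma> + of_nat k) / fact k * z ^ k) \<le> M k"
    by (rule hyp2F1_reg_majorant[OF assms(1), of N]) (rule that)
  show ?thesis
    unfolding hyp2F1_reg_def
  proof (rule Weierstrass_m_test_ev[OF _ M(1)])
    show "\<forall>\<^sub>F k in sequentially. \<forall>w\<in>X.
        norm (pochhammer (f w) k * pochhammer (g w) k * rGamma (h w + of_nat k) / fact k * z ^ k) \<le> M k"
      using eventually_ge_at_top[of "N + 1"] by eventually_elim (use M(2) assms(2) in blast)
  qed
qed

lemma hyp2F1_reg_sums:
  fixes z :: complex
  assumes "norm z < 1"
  shows "(\<lambda>k. pochhammer \<alpha> k * pochhammer \<beta> k * rGamma (\<gamma> + of_nat k) / fact k * z ^ k) sums hyp2F1_reg \<alpha> \<beta> \<gamma> z"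
proof -
  obtain N :: nat where "max (norm \<alpha>) (max (norm \<beta>) (norm \<gamma>)) \<le> real N"
    using real_arch_simple by blast
  \<comment> \<open>Constant parameters over a one-point set reduce the uniform limit to convergence
    of the series.\<close>
  then have "uniform_limit {()} (\<lambda>n _. \<Sum>k<n. pochhammer \<alpha> k * pochhammer \<beta> k * rGamma (\<gamma> + of_nat k) / fact k * z ^ k)
    (\<lambda>_. hyp2F1_reg \<alpha> \<beta> \<gamma> z) sequentially"
    by (intro hyp2F1_reg_uniform_limit[OF assms, of _ "\<lambda>_. \<alpha>" N "\<lambda>_. \<beta>" "\<lambda>_. \<gamma>"]) auto
  from tendsto_uniform_limitI[OF this, of "()"] show ?thesis
    by (simp add: sums_def)
qed

text \<open>A locally uniform limit of holomorphic partial sums: on each closed unit disc the three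
  parameter functions are bounded by a common \<open>N\<close>.\<close>

lemma hyp2F1_reg_holomorphic:
  fixes z :: complex
  assumes "norm z < 1" "f holomorphic_on UNIV" "g holomorphic_on UNIV" "h holomorphic_on UNIV"
  shows "(\<lambda>w. hyp2F1_reg (f w) (g w) (h w) z) holomorphic_on UNIV"
proof (rule holomorphic_uniform_sequence)
  show "(\<lambda>w. \<Sum>k<n. pochhammer (f w) k * pochhammer (g w) k * rGamma (h w + of_nat k) / fact k * z ^ k) holomorphic_on UNIV" for n
    unfolding pochhammer_prod using assms by (intro holomorphic_intros) auto
  fix w :: complex
  have "bounded (\<phi> ` cball w 1)" if "\<phi> holomorphic_on UNIV" for \<phi> :: "complex \<Rightarrow> complex"
    using that by (intro compact_imp_bounded compact_continuous_image compact_cball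
        holomorphic_on_imp_continuous_on) (auto intro: holomorphic_on_subset)
  then have "bounded (f ` cball w 1 \<union> g ` cball w 1 \<union> h ` cball w 1)"
    using assms by (intro bounded_Un[THEN iffD2] conjI) blast+
  then obtain b where b: "\<forall>y \<in> f ` cball w 1 \<union> g ` cball w 1 \<union> h ` cball w 1. norm y \<le> b"
    by (auto simp: bounded_iff)
  obtain N :: nat where "b \<le> real N"
    using real_arch_simple by blast
  with b have "norm (f y) \<le> real N \<and> norm (g y) \<le> real N \<and> norm (h y) \<le> real N" if "y \<in> cball w 1" for y
    using that by (meson UnI1 UnI2 imageI order.trans)
  then show "\<exists>d>0. cball w d \<subseteq> UNIV \<and> uniform_limit (cball w d)
      (\<lambda>n w. \<Sum>k<n. pochhammer (f w) k * pochhammer (g w) k * rGamma (h w + of_nat k) / fact k * z ^ k)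
      (\<lambda>w. hyp2F1_reg (f w) (g w) (h w) z) sequentially"
    by (intro exI[of _ 1] conjI hyp2F1_reg_uniform_limit[OF assms(1), of _ _ N]) auto
qed auto

lemma hyp2F1_eq_Gamma_mult_reg:
  assumes "norm z < 1" "\<gamma> \<notin> \<int>\<^sub>\<le>\<^sub>0"
  shows "hyp2F1 \<alpha> \<beta> \<gamma> z = Gamma \<gamma> * hyp2F1_reg \<alpha> \<beta> \<gamma> z"
proof -
  have "(pochhammer \<alpha> k * pochhammer \<beta> k) / (pochhammer \<gamma> k * pochhammer 1 k) * z ^ k =
      Gamma \<gamma> * (pochhammer \<alpha> k * pochhammer \<beta> k * rGamma (\<gamma> + of_nat k) / fact k * z ^ k)" for k
    using assms(2) by (simp add: pochhammer_Gamma[OF assms(2)] rGamma_inverse_Gamma pochhammer_fact field_simps)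
  then show ?thesis
    unfolding hyp2F1_def using sums_mult[OF hyp2F1_reg_sums[OF assms(1)], of "Gamma \<gamma>" \<alpha> \<beta> \<gamma>]
    by (simp add: sums_iff)
qed

section \<open>The hypergeometric family as a function of w\<close>

definition hgf_reg :: "real \<Rightarrow> real \<Rightarrow> real \<Rightarrow> real \<Rightarrow> real \<Rightarrow> real \<Rightarrow> complex \<Rightarrow> complex" where
  "hgf_reg p q r a b x w =
     hyp2F1_reg (of_real p * w + of_real a) (of_real q * w + of_real b) (of_real r * w) (of_real x)"

lemma hgf_reg_holomorphic [holomorphic_intros]:
  "\<bar>x\<bar> < 1 \<Longrightarrow> hgf_reg p q r a b x holomorphic_on A"
  unfolding hgf_reg_def
  by (rule holomorphic_on_subset[OF hyp2F1_reg_holomorphic]) (auto intro!: holomorphic_intros)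

lemma hgf_eq_Gamma_mult_reg:
  "\<bar>x\<bar> < 1 \<Longrightarrow> of_real r * w \<notin> \<int>\<^sub>\<le>\<^sub>0 \<Longrightarrow> hgf p q r a b x w = Gamma (of_real r * w) * hgf_reg p q r a b x w"
  unfolding hgf_def hgf_reg_def by (rule hyp2F1_eq_Gamma_mult_reg) auto

lemma hgf_holomorphic:
  assumes "\<bar>x\<bar> < 1" "r > 0"
  shows "hgf p q r a b x holomorphic_on {w. Re w > 0}"
proof -
  have *: "of_real r * w \<notin> \<int>\<^sub>\<le>\<^sub>0" if "Re w > 0" for w
  proof
    assume "of_real r * w \<in> \<int>\<^sub>\<le>\<^sub>0"
    then obtain n where "of_real r * w = - of_nat n" by (auto elim!: nonpos_Ints_cases')
    from arg_cong[OF this, of Re] have "r * Re w = - real n" by simp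
    moreover have "r * Re w > 0" using assms that by simp
    ultimately show False by simp
  qed
  have "(\<lambda>w. Gamma (of_real r * w) * hgf_reg p q r a b x w) holomorphic_on {w. Re w > 0}"
    using * assms by (intro holomorphic_intros) auto
  then show ?thesis
    using * assms by (subst holomorphic_cong[OF refl hgf_eq_Gamma_mult_reg]) auto
qed

lemma isCont_hgf:
  assumes "\<bar>x\<bar> < 1" "r > 0" "Re w > 0"
  shows "isCont (hgf p q r a b x) w"
  using holomorphic_on_imp_continuous_on[OF hgf_holomorphic[OF assms(1,2)]] assms(3)
  by (auto simp: continuous_on_eq_continuous_at open_halfspace_Re_gt)

section \<open>Rational functions and the recurrence\<close>

lemma eventually_cosparse_UNIV_iff:
  "eventually P (cosparse UNIV) \<longleftrightarrow> (\<forall>z. eventually P (at z))"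
  by (simp add: eventually_cosparse_open_eq)

lemma eventually_cosparse_UNIV_shift:
  fixes c :: complex
  assumes "eventually P (cosparse UNIV)"
  shows "eventually (\<lambda>w. P (w + c)) (cosparse UNIV)"
  unfolding eventually_cosparse_UNIV_iff
proof
  fix z
  have "filtermap (\<lambda>w. w + c) (at z) = at (z + c)"
    using filtermap_at_shift[of "-c" z] by simp
  moreover have "eventually P (at (z + c))"
    using assms by (simp add: eventually_cosparse_UNIV_iff)
  ultimately show "eventually (\<lambda>w. P (w + c)) (at z)"
    by (metis eventually_filtermap)
qed

lemma eventually_cosparse_poly_nonzero:
  fixes P :: "complex poly"
  assumes "P \<noteq> 0"
  shows "\<forall>\<^sub>\<approx>w\<in>UNIV. poly P w \<noteq> 0"
  using assms by (auto simp: eventually_cosparse intro!: finite_imp_sparse poly_roots_finite)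

text \<open>Both values are limits along the punctured neighbourhood. This upgrades identities known
  off a sparse set to pointwise ones.\<close>

lemma eventually_cosparse_imp_eq_isCont:
  fixes f g :: "complex \<Rightarrow> complex"
  assumes "\<forall>\<^sub>F w in at z. f w = g w" "isCont f z" "isCont g z"
  shows "f z = g z"
proof (rule tendsto_unique)
  show "(f \<longlongrightarrow> f z) (at z)"
    using assms(2) by (simp add: isCont_def)
  have "(g \<longlongrightarrow> g z) (at z)"
    using assms(3) by (simp add: isCont_def)
  moreover have "\<forall>\<^sub>F w in at z. g w = f w"
    using assms(1) by eventually_elim simp
  ultimately show "(f \<longlongrightarrow> g z) (at z)"
    by (rule Lim_transform_eventually)
qed auto

text \<open>Continuity keeps f nonzero near \<open>s\<close>, so denominators can be cleared there;
  the cleared identity then extends by continuity to \<open>s\<close> itself.\<close>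

lemma hgf_recurrence_of_ratio:
  fixes X Y :: "complex \<Rightarrow> complex"
  assumes "\<bar>x\<bar> < 1" "r > 0" "s > 0" "hgf p q r a b x (of_real s) \<noteq> 0"
    and "\<forall>\<^sub>\<approx>w\<in>UNIV. hgf_ratio p q r a b x w * Y w = X w" "isCont X (of_real s)" "isCont Y (of_real s)"
  shows "hgf p q r a b x (of_real s + 1) * Y (of_real s) = hgf p q r a b x (of_real s) * X (of_real s)"
proof -
  let ?f = "hgf p q r a b x" and ?z = "complex_of_real s"
  have cont: "isCont ?f ?z" "isCont ?f (?z + 1)"
    using assms by (auto intro!: isCont_hgf)
  then have "isCont (\<lambda>w. ?f (w + 1)) ?z"
    using isCont_o2[of ?z "\<lambda>w. w + 1" ?f] by simp
  moreover have "\<forall>\<^sub>F w in at ?z. ?f w \<noteq> 0"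
    using cont(1) assms(4) by (simp add: isCont_def tendsto_imp_eventually_ne)
  then have "\<forall>\<^sub>F w in at ?z. ?f (w + 1) * Y w = ?f w * X w"
    using eventually_cosparse_imp_eventually_at[OF assms(5) UNIV_I, of ?z UNIV]
    by eventually_elim (auto simp: hgf_ratio_def field_simps)
  ultimately show ?thesis
    using assms cont(1) by (intro eventually_cosparse_imp_eq_isCont[of _ _ ?z]) (auto intro!: continuous_intros)
qed

lemma poly_map_cnj_cnj: "poly (map_poly cnj p) (cnj z) = cnj (poly p z)"
  by (induction p) (simp_all add: map_poly_pCons)

lemma poly_eq_0_if_reals:
  fixes P :: "complex poly"
  assumes "\<And>s. s > W \<Longrightarrow> poly P (of_real s) = 0"
  shows "P = 0"
proof (rule ccontr)
  assume "P \<noteq> 0"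
  then have "finite {z. poly P z = 0}"
    by (rule poly_roots_finite)
  moreover have "complex_of_real ` {W<..} \<subseteq> {z. poly P z = 0}"
    using assms by auto
  ultimately have "finite (complex_of_real ` {W<..})"
    by (rule finite_subset[rotated])
  then have "finite {W<..}"
    by (rule finite_imageD) (auto simp: inj_on_def)
  then show False
    using infinite_Ioi by blast
qed

text \<open>If \<open>P / Q\<close> is real on a real half-line then \<open>P Q\<^sup>*\<close>, where \<open>*\<close> conjugates the
  coefficients, equals its own conjugate, and \<open>P / Q = P Q\<^sup>* / (Q Q\<^sup>*)\<close>.\<close>

lemma rational_over_Reals:
  assumes "Q \<noteq> 0" and "\<forall>\<^sub>\<approx>w\<in>UNIV. F w = poly P w / poly Q w"
    and real: "\<And>s. s > W \<Longrightarrow> poly P (of_real s) * cnj (poly Q (of_real s)) \<in> \<real>"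
  shows "rational_over \<real> F"
proof -
  define P' where "P' = map_poly cnj P"
  define Q' where "Q' = map_poly cnj Q"
  have cnj_mult: "map_poly cnj (A * B) = map_poly cnj A * map_poly cnj B" for A B
    by (rule poly_eqI) (simp add: coeff_map_poly coeff_mult)
  have inv: "map_poly cnj (map_poly cnj A) = A" for A
    by (rule poly_eqI) (simp add: coeff_map_poly)
  have "Q' \<noteq> 0"
    using assms(1) by (auto simp: Q'_def poly_eq_iff coeff_map_poly)
  have "P * Q' - P' * Q = 0"
  proof (rule poly_eq_0_if_reals)
    fix s assume "s > W"
    from real[OF this] have "cnj (poly P (of_real s) * cnj (poly Q (of_real s))) = poly P (of_real s) * cnj (poly Q (of_real s))"
      by (simp only: Reals_cnj_iff)
    then show "poly (P * Q' - P' * Q) (of_real s) = 0"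
      using poly_map_cnj_cnj[of P "of_real s"] poly_map_cnj_cnj[of Q "of_real s"]
      by (simp add: P'_def Q'_def)
  qed
  then have "map_poly cnj (P * Q') = P * Q'" "map_poly cnj (Q * Q') = Q * Q'"
    by (simp_all add: cnj_mult P'_def Q'_def inv mult.commute)
  then have real: "coeff (P * Q') i \<in> \<real>" "coeff (Q * Q') i \<in> \<real>" for i
    unfolding Reals_cnj_iff by (metis coeff_map_poly complex_cnj_zero)+
  have "\<forall>\<^sub>\<approx>w\<in>UNIV. F w = poly (P * Q') w / poly (Q * Q') w"
    using assms(2) eventually_cosparse_poly_nonzero[OF \<open>Q' \<noteq> 0\<close>]
    by eventually_elim simp
  then show ?thesis
    unfolding rational_over_def using assms(1) \<open>Q' \<noteq> 0\<close> real
    by (intro exI[of _ "P * Q'"] exI[of _ "Q * Q'"]) auto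
qed

text \<open>This supplies the premise of the reality clause of \<open>canonical_form\<close>:
  positivity of f on a half-line makes the ratio real there.\<close>

lemma hgf_ratio_rational_over_Reals:
  assumes "\<bar>x\<bar> < 1" "r > 0" "closed_form p q r a b x"
    and F: "\<And>s. s > A \<Longrightarrow> F s > 0"
    "\<And>s. s > A \<Longrightarrow> hgf p q r a b x (of_real s) = of_real (F s)"
  shows "rational_over \<real> (hgf_ratio p q r a b x)"
proof -
  from assms(3) obtain P Q where Q: "Q \<noteq> 0" and PQ: "\<forall>\<^sub>\<approx>w\<in>UNIV. hgf_ratio p q r a b x w = poly P w / poly Q w"
    by (auto simp: closed_form_def rational_over_def)
  have rec: "\<forall>\<^sub>\<approx>w\<in>UNIV. hgf_ratio p q r a b x w * poly Q w = poly P w"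
    using PQ eventually_cosparse_poly_nonzero[OF Q] by eventually_elim simp
  show ?thesis
  proof (rule rational_over_Reals[OF Q PQ])
    fix s assume s: "s > max A 0"
    have "of_real (F (s + 1)) * poly Q (of_real s) = of_real (F s) * poly P (of_real s)"
      using hgf_recurrence_of_ratio[OF assms(1,2) _ _ rec, of s] s F(1)[of s] F(2)[of s] F(2)[of "s + 1"]
      by (simp add: continuous_at_imp_continuous_on)
    then have "poly P (of_real s) = of_real (F (s + 1) / F s) * poly Q (of_real s)"
      using F(1)[of s] s by (simp add: field_simps)
    \<comment> \<open>Multiplying by the conjugate of the denominator, instead of dividing by it,
      also covers zeros of \<open>Q\<close>.\<close>
    then have "poly P (of_real s) * cnj (poly Q (of_real s)) =
        of_real (F (s + 1) / F s) * (poly Q (of_real s) * cnj (poly Q (of_real s)))"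
      by (simp add: mult.assoc)
    also have "poly Q (of_real s) * cnj (poly Q (of_real s)) = of_real ((norm (poly Q (of_real s)))\<^sup>2)"
      by (simp only: complex_norm_square)
    finally show "poly P (of_real s) * cnj (poly Q (of_real s)) \<in> \<real>"
      by (simp only: Reals_mult Reals_of_real)
  qed
qed

section \<open>Asymptotics of polynomials and gamma quotients along z + k\<close>

text \<open>After division by the top power of \<open>k\<close>, the i-th monomial is ((z+k)/k)^i
  times (1/k)^(deg-i), so only the leading one survives.\<close>

lemma poly_shift_asymp:
  fixes P :: "complex poly"
  shows "(\<lambda>k. poly P (z + of_nat k) / of_nat k ^ degree P) \<longlonglongrightarrow> lead_coeff P"
proof -
  have lim: "(\<lambda>k. (z + of_nat k) / of_nat k) \<longlonglongrightarrow> 1"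
  proof (rule Lim_transform_eventually)
    show "(\<lambda>k. z * inverse (of_nat k) + 1) \<longlonglongrightarrow> 1"
      by (rule tendsto_eq_intros lim_inverse_n refl | simp)+
    show "\<forall>\<^sub>F k in sequentially. z * inverse (of_nat k) + 1 = (z + of_nat k) / of_nat k"
      using eventually_gt_at_top[of 0] by eventually_elim (simp add: field_simps)
  qed
  have "(\<lambda>k. \<Sum>i\<le>degree P. coeff P i * (((z + of_nat k) / of_nat k) ^ i * inverse (of_nat k) ^ (degree P - i)))
      \<longlonglongrightarrow> (\<Sum>i\<le>degree P. coeff P i * (1 ^ i * 0 ^ (degree P - i)))"
    by (intro tendsto_sum tendsto_mult tendsto_const tendsto_power lim lim_inverse_n)
  also have "(\<Sum>i\<le>degree P. coeff P i * (1 ^ i * 0 ^ (degree P - i))) = (\<Sum>i\<le>degree P. if i = degree P then coeff P i else 0)"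
    by (intro sum.cong) (auto simp: power_0_left)
  also have "\<dots> = lead_coeff P"
    by simp
  finally show ?thesis
  proof (rule Lim_transform_eventually)
    show "\<forall>\<^sub>F k in sequentially. (\<Sum>i\<le>degree P. coeff P i * (((z + of_nat k) / of_nat k) ^ i * inverse (of_nat k) ^ (degree P - i)))
       = poly P (z + of_nat k) / of_nat k ^ degree P"
      using eventually_gt_at_top[of 0]
    proof eventually_elim
      case (elim k)
      have "((z + of_nat k) / of_nat k) ^ i * inverse (of_nat k) ^ (degree P - i) = (z + of_nat k) ^ i / of_nat k ^ degree P"
        if "i \<le> degree P" for i
      proof -
        have "(of_nat k :: complex) ^ degree P = of_nat k ^ i * of_nat k ^ (degree P - i)"
          using that by (simp flip: power_add)
        then show ?thesis by (simp add: power_divide field_simps)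
      qed
      then show ?case
        by (simp add: poly_altdef sum_divide_distrib)
    qed
  qed
qed

lemma poly_shift_ratio_tendsto:
  fixes P :: "complex poly"
  assumes "P \<noteq> 0"
  shows "(\<lambda>k. poly P (z + of_nat k) / poly P (w + of_nat k)) \<longlonglongrightarrow> 1"
proof -
  have "(\<lambda>k. (poly P (z + of_nat k) / of_nat k ^ degree P) / (poly P (w + of_nat k) / of_nat k ^ degree P))
      \<longlonglongrightarrow> lead_coeff P / lead_coeff P"
    using assms by (intro tendsto_divide poly_shift_asymp) auto
  then have "(\<lambda>k. (poly P (z + of_nat k) / of_nat k ^ degree P) / (poly P (w + of_nat k) / of_nat k ^ degree P))
      \<longlonglongrightarrow> 1"
    using assms by simp
  then show ?thesis
  proof (rule Lim_transform_eventually)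
    show "\<forall>\<^sub>F k in sequentially. (poly P (z + of_nat k) / of_nat k ^ degree P) / (poly P (w + of_nat k) / of_nat k ^ degree P)
      = poly P (z + of_nat k) / poly P (w + of_nat k)"
      using eventually_gt_at_top[of 0] by eventually_elim simp
  qed
qed

text \<open>The subleading coefficient converts reality of the products in a canonical form into
  reality of the sums of the \<open>u i\<close> and of the \<open>v j\<close>.\<close>

lemma monic_linear_prod:
  fixes u :: "nat \<Rightarrow> complex"
  shows "degree (\<Prod>i=1..m. [:u i, 1:]) = m" "lead_coeff (\<Prod>i=1..m. [:u i, 1:]) = 1"
    "m > 0 \<Longrightarrow> coeff (\<Prod>i=1..m. [:u i, 1:]) (m - 1) = (\<Sum>i=1..m. u i)"
proof -
  have "degree (\<Prod>i=1..m. [:u i, 1:]) = m \<and> lead_coeff (\<Prod>i=1..m. [:u i, 1:]) = 1 \<and>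
     (m > 0 \<longrightarrow> coeff (\<Prod>i=1..m. [:u i, 1:]) (m - 1) = (\<Sum>i=1..m. u i))"
  proof (induction m)
    case (Suc m)
    define P where "P = (\<Prod>i=1..m. [:u i, 1:])"
    have P: "degree P = m" "coeff P m = 1" "m > 0 \<Longrightarrow> coeff P (m - 1) = (\<Sum>i=1..m. u i)" "P \<noteq> 0"
      using Suc by (auto simp: P_def)
    have eq: "(\<Prod>i=1..Suc m. [:u i, 1:]) = [:u (Suc m), 1:] * P"
      by (simp add: P_def mult.commute)
    have "degree ([:u (Suc m), 1:] * P) = Suc m"
      using P by (subst degree_mult_eq) auto
    moreover have "lead_coeff ([:u (Suc m), 1:] * P) = 1"
      using P by (simp add: lead_coeff_mult del: mult_pCons_left)
    moreover have "coeff ([:u (Suc m), 1:] * P) m = (\<Sum>i=1..Suc m. u i)"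
      using P by (cases m) (auto simp: coeff_pCons)
    ultimately show ?case
      unfolding eq by simp
  qed simp
  then show "degree (\<Prod>i=1..m. [:u i, 1:]) = m" "lead_coeff (\<Prod>i=1..m. [:u i, 1:]) = 1"
    "m > 0 \<Longrightarrow> coeff (\<Prod>i=1..m. [:u i, 1:]) (m - 1) = (\<Sum>i=1..m. u i)"
    by auto
qed

text \<open>This is Gauss's limit formula for 1/Gamma multiplied by \<open>Gamma z\<close>: its
  Pochhammer symbol of length \<open>k + 1\<close> becomes Gamma(z+k+1)/Gamma(z).\<close>

lemma Gamma_shift_asymp:
  fixes z :: complex
  assumes "z \<notin> \<int>\<^sub>\<le>\<^sub>0"
  shows "(\<lambda>k. Gamma (z + of_nat (k + 1)) / (fact k * exp (z * of_real (ln (of_nat k))))) \<longlonglongrightarrow> 1"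
proof -
  have "(\<lambda>k. Gamma z * rGamma_series z k) \<longlonglongrightarrow> Gamma z * rGamma z"
    by (intro tendsto_intros)
  moreover have "Gamma z * rGamma_series z k = Gamma (z + of_nat (k + 1)) / (fact k * exp (z * of_real (ln (of_nat k))))" for k
    unfolding rGamma_series_def pochhammer_Gamma[OF assms] using Gamma_nonzero[OF assms] by simp
  moreover have "Gamma z * rGamma z = 1"
    using Gamma_nonzero[OF assms] by (simp add: rGamma_inverse_Gamma)
  ultimately show ?thesis by simp
qed

text \<open>Both products have \<open>m\<close> factors, so the factorials and the powers k^(mz)
  cancel. What remains is k^(sum u - sum v), independent of \<open>z\<close>.\<close>

lemma Gamma_prod_quotient_asymp:
  fixes u v :: "nat \<Rightarrow> complex" and z :: complex
  assumes "\<And>i. i \<in> {1..m} \<Longrightarrow> z + u i \<notin> \<int>\<^sub>\<le>\<^sub>0 \<and> z + v i \<notin> \<int>\<^sub>\<le>\<^sub>0"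
  shows "(\<lambda>k. (\<Prod>i=1..m. Gamma (z + of_nat (k + 1) + u i)) / (\<Prod>i=1..m. Gamma (z + of_nat (k + 1) + v i)) /
     exp (((\<Sum>i=1..m. u i) - (\<Sum>i=1..m. v i)) * of_real (ln (of_nat k)))) \<longlonglongrightarrow> 1"
proof -
  define E where "E = (\<lambda>z k. fact k * exp (z * complex_of_real (ln (of_nat k))))"
  have "(\<lambda>k. (\<Prod>i=1..m. Gamma (z + u i + of_nat (k + 1)) / E (z + u i) k) /
      (\<Prod>i=1..m. Gamma (z + v i + of_nat (k + 1)) / E (z + v i) k)) \<longlonglongrightarrow> (\<Prod>i=1..m. 1) / (\<Prod>i=1..m. 1)"
    unfolding E_def using assms by (intro tendsto_divide tendsto_prod Gamma_shift_asymp) auto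
  moreover have "(\<Prod>i=1..m. Gamma (z + u i + of_nat (k + 1)) / E (z + u i) k) /
      (\<Prod>i=1..m. Gamma (z + v i + of_nat (k + 1)) / E (z + v i) k) =
     (\<Prod>i=1..m. Gamma (z + of_nat (k + 1) + u i)) / (\<Prod>i=1..m. Gamma (z + of_nat (k + 1) + v i)) /
     exp (((\<Sum>i=1..m. u i) - (\<Sum>i=1..m. v i)) * of_real (ln (of_nat k)))" for k
  proof -
    have E: "(\<Prod>i=1..m. E (z + u i) k) = fact k ^ m * exp ((of_nat m * z + (\<Sum>i=1..m. u i)) * of_real (ln (of_nat k)))" for u
    proof -
      have "(\<Prod>i=1..m. E (z + u i) k) = fact k ^ m * exp (\<Sum>i=1..m. (z + u i) * complex_of_real (ln (of_nat k)))"
        by (simp add: E_def prod.distrib exp_sum)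
      also have "(\<Sum>i=1..m. (z + u i) * complex_of_real (ln (of_nat k))) = (of_nat m * z + (\<Sum>i=1..m. u i)) * of_real (ln (of_nat k))"
        by (simp add: sum.distrib flip: sum_distrib_right)
      finally show ?thesis .
    qed
    have "exp ((of_nat m * z + (\<Sum>i=1..m. u i)) * of_real (ln (of_nat k))) =
       exp ((of_nat m * z + (\<Sum>i=1..m. v i)) * of_real (ln (of_nat k))) *
       exp (((\<Sum>i=1..m. u i) - (\<Sum>i=1..m. v i)) * complex_of_real (ln (of_nat k)))"
      by (simp add: algebra_simps flip: exp_add)
    then show ?thesis
      unfolding prod_dividef E by (simp add: add_ac)
  qed
  ultimately show ?thesis by simp
qed

section \<open>The gamma product\<close>

text \<open>\<open>F\<close> and the product \<open>G\<close> obey the same first-order recurrence,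
  so \<open>Q = F / G\<close> has period 1 and \<open>Q s\<close> is the limit of
  \<open>Y s k\<close>. The sequence \<open>Y\<close> shows both that \<open>Q\<close> is real and
  that it is constant.\<close>

lemma gamma_product_on_half_line:
  fixes F :: "real \<Rightarrow> real" and A B :: "complex poly" and u v :: "nat \<Rightarrow> complex" and m :: nat
  defines "H \<equiv> \<lambda>z. (\<Prod>i=1..m. Gamma (z + u i)) / (\<Prod>i=1..m. Gamma (z + v i))"
  assumes D: "D > 0" and Fpos: "\<And>s. s > W \<Longrightarrow> F s > 0"
    and lim: "\<And>\<sigma>. \<sigma> > 0 \<Longrightarrow> ((\<lambda>y. F (y + \<sigma>) / F y) \<longlongrightarrow> D powr \<sigma>) at_top"
    and nz: "\<And>s. s > W \<Longrightarrow> poly A (of_real s) \<noteq> 0 \<and> poly B (of_real s) \<noteq> 0"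
    and uv: "\<And>s i. s > W \<Longrightarrow> i \<in> {1..m} \<Longrightarrow> of_real s + u i \<notin> \<int>\<^sub>\<le>\<^sub>0 \<and> of_real s + v i \<notin> \<int>\<^sub>\<le>\<^sub>0"
    and rec: "\<And>s. s > W \<Longrightarrow> of_real (F (s + 1) / F s) =
       poly A (of_real s + 1) / poly A (of_real s) * (poly B (of_real s) / poly B (of_real s + 1)) * of_real D *
       ((\<Prod>i=1..m. of_real s + u i) / (\<Prod>i=1..m. of_real s + v i))"
    and real: "\<And>i. coeff A i \<in> \<real> \<and> coeff B i \<in> \<real>" "(\<Sum>i=1..m. u i) - (\<Sum>i=1..m. v i) \<in> \<real>"
  obtains c :: real where "c \<noteq> 0"
    "\<forall>s>W. of_real (F s) = of_real c * (poly A (of_real s) / poly B (of_real s)) * of_real (D powr s) * H (of_real s)"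
proof -
  define e where "e = (\<Sum>i=1..m. u i) - (\<Sum>i=1..m. v i)"
  \<comment> \<open>This is k^e, the growth of \<open>H\<close> at distance \<open>k + 1\<close>;
    independent of the base point, it cancels in \<open>Y s k / Y t k\<close>.\<close>
  define X where "X = (\<lambda>k. exp (e * complex_of_real (ln (of_nat k))))"
  define G where "G = (\<lambda>s. poly A (of_real s) / poly B (of_real s) * of_real (D powr s) * H (of_real s))"
  define Q where "Q = (\<lambda>s. of_real (F s) / G s)"
  define Y where "Y = (\<lambda>s k. of_real (F (s + real (k + 1))) /
     (poly A (of_real (s + real (k + 1))) / poly B (of_real (s + real (k + 1))) * of_real (D powr (s + real (k + 1))) * X k))"
  have H0: "H (of_real s) \<noteq> 0" if "s > W" for s
    using uv[OF that] by (auto simp: H_def Gamma_eq_zero_iff)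
  have Qnz: "Q s \<noteq> 0" "G s \<noteq> 0" if "s > W" for s
    using H0[OF that] nz[OF that] D Fpos[OF that] by (auto simp: G_def Q_def)
  have Q_step: "Q (s + 1) = Q s" if "s > W" for s
  proof -
    have step: "(\<Prod>i=1..m. Gamma (of_real s + 1 + y i)) = (\<Prod>i=1..m. of_real s + y i) * (\<Prod>i=1..m. Gamma (of_real s + y i))"
      if "\<And>i. i \<in> {1..m} \<Longrightarrow> of_real s + y i \<notin> \<int>\<^sub>\<le>\<^sub>0" for y :: "nat \<Rightarrow> complex"
    proof -
      have "Gamma (of_real s + 1 + y i) = (of_real s + y i) * Gamma (of_real s + y i)" if "i \<in> {1..m}" for i
        using Gamma_plus1[of "of_real s + y i"] \<open>\<And>i. i \<in> {1..m} \<Longrightarrow> of_real s + y i \<notin> \<int>\<^sub>\<le>\<^sub>0\<close>[OF that] by (simp add: add_ac)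
      then show ?thesis by (simp flip: prod.distrib)
    qed
    have "H (of_real (s + 1)) = (\<Prod>i=1..m. of_real s + u i) / (\<Prod>i=1..m. of_real s + v i) * H (of_real s)"
      using step[of u] step[of v] uv[OF that] by (simp add: H_def)
    moreover have "D powr (s + 1) = D powr s * D"
      using D by (simp add: powr_add)
    ultimately have "G (s + 1) = of_real (F (s + 1) / F s) * G s"
      unfolding rec[OF that] G_def using nz[OF that] by simp
    then show ?thesis
      using Qnz[OF that] Fpos[OF that] Fpos[of "s + 1"] that by (simp add: Q_def)
  qed
  have Q_nat: "Q (s + real k) = Q s" if "s > W" for s k
  proof (induction k)
    case (Suc k)
    then show ?case using Q_step[of "s + real k"] that by (simp add: add_ac)
  qed simp
  \<comment> \<open>\<open>Y s k\<close> is \<open>F / G\<close> at \<open>s + k + 1\<close> with \<open>H\<close> replaced by its asymptotics, which, unlike \<open>H\<close>, is visibly real.\<close>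
  have Y_lim: "(\<lambda>k. Y s k) \<longlonglongrightarrow> Q s" if "s > W" for s
  proof -
    have "(\<lambda>k. H (of_real s + of_nat (k + 1)) / X k) \<longlonglongrightarrow> 1"
      unfolding H_def X_def e_def using uv[OF that] by (intro Gamma_prod_quotient_asymp) auto
    then have "(\<lambda>k. Q s * (H (of_real s + of_nat (k + 1)) / X k)) \<longlonglongrightarrow> Q s * 1"
      by (intro tendsto_mult_left)
    moreover have "Q s * (H (of_real s + of_nat (k + 1)) / X k) = Y s k" for k
    proof -
      have "Q s = Q (s + real (k + 1))"
        using Q_nat[OF that] by metis
      then show ?thesis
        using H0[of "s + real (k + 1)"] that by (simp add: Q_def Y_def G_def)
    qed
    ultimately show ?thesis by simp
  qed
  \<comment> \<open>Every \<open>Y s k\<close> is real because \<open>e\<close> and the coefficients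
    of \<open>A\<close> and \<open>B\<close> are, and the reals are closed. Hence the final constant
    \<open>c\<close> is real.\<close>
  have Q_real: "Q s \<in> \<real>" if "s > W" for s
  proof (rule closed_sequentially[OF closed_complex_Reals _ Y_lim[OF that]])
    have poly_real: "poly P (of_real y) \<in> \<real>" if "\<And>i. coeff P i \<in> \<real>" for P :: "complex poly" and y
      unfolding poly_altdef using that by (intro sum_in_Reals Reals_mult Reals_power Reals_of_real) auto
    obtain e' where "e = of_real e'"
      using real(2) by (auto simp: e_def elim: Reals_cases)
    then have X: "X k = of_real (exp (e' * ln (of_nat k)))" for k
      unfolding X_def by (simp only: flip: of_real_mult exp_of_real)
    show "Y s k \<in> \<real>" for k
      unfolding Y_def X using real(1) by (intro Reals_divide Reals_mult Reals_of_real poly_real) auto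
  qed
  have Q_const: "Q t = Q s" if "t > W" "s > t" for s t
  proof -
    have s: "s > W" using that by simp
    define \<sigma> where "\<sigma> = s - t"
    have "filterlim (\<lambda>k. t + real (k + 1)) at_top sequentially"
      by real_asymp
    from filterlim_compose[OF lim[of \<sigma>] this]
    have limF: "(\<lambda>k. F (t + real (k + 1) + \<sigma>) / F (t + real (k + 1))) \<longlonglongrightarrow> D powr \<sigma>"
      using that by (simp add: \<sigma>_def)
    have eq: "complex_of_real (y + real (k + 1)) = (of_real y + 1) + of_nat k" for y k
      by simp
    \<comment> \<open>The polynomial quotients tend to 1, and the limit
      \<open>D powr \<sigma>\<close> of the quotient of \<open>F\<close> cancels against the
      exponential factor.\<close>
    have "(\<lambda>k. complex_of_real (F (t + real (k + 1) + \<sigma>) / F (t + real (k + 1))) *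
        (poly A (of_real (t + real (k + 1))) / poly A (of_real (s + real (k + 1)))) *
        (poly B (of_real (s + real (k + 1))) / poly B (of_real (t + real (k + 1)))) * of_real (D powr (- \<sigma>)))
      \<longlonglongrightarrow> of_real (D powr \<sigma>) * 1 * 1 * of_real (D powr (- \<sigma>))"
      unfolding eq using nz[of "W + 1"] 
      by (intro tendsto_mult tendsto_const tendsto_of_real limF poly_shift_ratio_tendsto) auto
    moreover have "complex_of_real (F (t + real (k + 1) + \<sigma>) / F (t + real (k + 1))) *
        (poly A (of_real (t + real (k + 1))) / poly A (of_real (s + real (k + 1)))) *
        (poly B (of_real (s + real (k + 1))) / poly B (of_real (t + real (k + 1)))) * of_real (D powr (- \<sigma>))
       = Y s k / Y t k" for k
    proof -
      define t' where "t' = t + real (k + 1)"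
      define s' where "s' = s + real (k + 1)"
      have "t' + \<sigma> = s'" "s' > W" "t' > W"
        using that by (auto simp: \<sigma>_def s'_def t'_def)
      moreover have "complex_of_real (D powr (- \<sigma>)) = of_real (D powr t') / of_real (D powr s')"
        by (simp add: \<sigma>_def s'_def t'_def flip: of_real_divide powr_diff)
      moreover have "X k \<noteq> 0" by (simp add: X_def)
      ultimately show ?thesis
        unfolding Y_def s'_def[symmetric] t'_def[symmetric]
        using D nz[of s'] nz[of t'] Fpos[of s'] Fpos[of t'] by (simp add: field_simps)
    qed
    moreover have "of_real (D powr \<sigma>) * 1 * 1 * complex_of_real (D powr (- \<sigma>)) = 1"
      using D by (simp flip: of_real_mult powr_add)
    ultimately have "(\<lambda>k. Y s k / Y t k) \<longlonglongrightarrow> 1" by simp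
    moreover have "(\<lambda>k. Y s k / Y t k) \<longlonglongrightarrow> Q s / Q t"
      using Qnz[OF that(1)] by (intro tendsto_divide Y_lim that(1) s)
    ultimately have "Q s / Q t = 1"
      using LIMSEQ_unique by blast
    then show ?thesis using Qnz[OF that(1)] by simp
  qed
  obtain c where c: "Q (W + 1) = of_real c"
    using Q_real[of "W + 1"] by (auto elim: Reals_cases)
  have "Q s = of_real c" if "s > W" for s
    using Q_const[of s "W + 1"] Q_const[of "W + 1" s] that c by (cases s "W + 1" rule: linorder_cases) auto
  then have "\<forall>s>W. of_real (F s) = of_real c * G s"
    using Qnz by (auto simp: Q_def field_simps)
  moreover have "c \<noteq> 0"
    using Qnz[of "W + 1"] c by auto
  ultimately show thesis
    by (intro that) (auto simp: G_def mult_ac)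
qed

section \<open>Consequences of a canonical form on a real half-line\<close>

text \<open>Along \<open>s + k\<close> the ratio of \<open>F\<close> has a finite nonzero limit,
  whereas the right-hand side grows like d k^(deg U - deg V).\<close>

lemma canonical_form_degree:
  fixes F :: "real \<Rightarrow> real" and A B U V :: "complex poly"
  assumes "D > 0" and lim: "((\<lambda>y. F (y + 1) / F y) \<longlongrightarrow> D) at_top"
    and nz: "\<And>s. s > W \<Longrightarrow> poly A (of_real s) \<noteq> 0 \<and> poly B (of_real s) \<noteq> 0"
    and rec: "\<And>s. s > W \<Longrightarrow> of_real (F (s + 1) / F s) =
       poly A (of_real s + 1) / poly A (of_real s) * (poly B (of_real s) / poly B (of_real s + 1)) * d *
       (poly U (of_real s) / poly V (of_real s))"
    and UV: "lead_coeff U = 1" "lead_coeff V = 1" and "d \<noteq> 0"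
  shows "degree U = degree V \<and> d = of_real D"
proof -
  let ?m = "degree U" and ?n = "degree V"
  define s where "s = W + 1"
  have AB: "A \<noteq> 0" "B \<noteq> 0" using nz[of s] by (auto simp: s_def)
  have "filterlim (\<lambda>k. s + real k) at_top sequentially"
    by real_asymp
  from filterlim_compose[OF lim this]
  have limF: "(\<lambda>k. F (s + real k + 1) / F (s + real k)) \<longlonglongrightarrow> D" by simp
  define z where "z = complex_of_real s"
  \<comment> \<open>Moving every factor with a known limit to the side of \<open>F\<close> leaves
    \<open>T k\<close>, which therefore tends to \<open>D\<close>.\<close>
  define T where "T = (\<lambda>k. of_nat k ^ ?m / of_nat k ^ ?n * d :: complex)"
  have "(\<lambda>k. complex_of_real (F (s + real k + 1) / F (s + real k)) *
      (poly A (z + of_nat k) / poly A (z + 1 + of_nat k)) * (poly B (z + 1 + of_nat k) / poly B (z + of_nat k)) *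
      ((poly V (z + of_nat k) / of_nat k ^ ?n) / (poly U (z + of_nat k) / of_nat k ^ ?m)))
     \<longlonglongrightarrow> of_real D * 1 * 1 * (lead_coeff V / lead_coeff U)"
    using AB UV by (intro tendsto_mult tendsto_divide tendsto_of_real limF poly_shift_ratio_tendsto poly_shift_asymp) auto
  then have "(\<lambda>k. complex_of_real (F (s + real k + 1) / F (s + real k)) *
      (poly A (z + of_nat k) / poly A (z + 1 + of_nat k)) * (poly B (z + 1 + of_nat k) / poly B (z + of_nat k)) *
      ((poly V (z + of_nat k) / of_nat k ^ ?n) / (poly U (z + of_nat k) / of_nat k ^ ?m)))
     \<longlonglongrightarrow> of_real D"
    using UV by simp
  moreover have "\<forall>\<^sub>F k in sequentially. complex_of_real (F (s + real k + 1) / F (s + real k)) *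
      (poly A (z + of_nat k) / poly A (z + 1 + of_nat k)) * (poly B (z + 1 + of_nat k) / poly B (z + of_nat k)) *
      ((poly V (z + of_nat k) / of_nat k ^ ?n) / (poly U (z + of_nat k) / of_nat k ^ ?m)) = T k"
  proof -
    have nzU: "\<forall>\<^sub>F k in sequentially. poly P (z + of_nat k) \<noteq> 0" if "lead_coeff P = 1" for P
    proof -
      have "\<forall>\<^sub>F k in sequentially. poly P (z + of_nat k) / of_nat k ^ degree P \<noteq> 0"
        using poly_shift_asymp[of P z] that by (intro tendsto_imp_eventually_ne) auto
      then show ?thesis by eventually_elim auto
    qed
    show ?thesis
      using nzU[OF UV(1)] nzU[OF UV(2)] eventually_gt_at_top[of 0]
    proof eventually_elim
      case (elim k)
      have R: "complex_of_real (F (s + real k + 1) / F (s + real k)) =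
       poly A (z + 1 + of_nat k) / poly A (z + of_nat k) * (poly B (z + of_nat k) / poly B (z + 1 + of_nat k)) * d *
       (poly U (z + of_nat k) / poly V (z + of_nat k))"
        using rec[of "s + real k"] by (simp add: s_def z_def add_ac)
      have "poly A (z + of_nat k) \<noteq> 0" "poly B (z + of_nat k) \<noteq> 0"
        "poly A (z + 1 + of_nat k) \<noteq> 0" "poly B (z + 1 + of_nat k) \<noteq> 0"
        using nz[of "s + real k"] nz[of "s + real k + 1"] by (simp_all add: s_def z_def add_ac)
      then show ?case
        unfolding R using elim by (simp add: T_def field_simps)
    qed
  qed
  ultimately have T: "T \<longlonglongrightarrow> of_real D"
    by (rule Lim_transform_eventually)
  have inv0: "(\<lambda>k. inverse (of_nat k) ^ j :: complex) \<longlonglongrightarrow> 0" if "j > 0" for j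
    using tendsto_power[OF lim_inverse_n, of j] that by (simp add: power_0_left)
  have "?m = ?n"
  proof (rule linorder_cases[of ?m ?n])
    assume less: "?m < ?n"
    have "(\<lambda>k. inverse (of_nat k) ^ (?n - ?m) * d) \<longlonglongrightarrow> 0 * d"
      using less by (intro tendsto_mult inv0 tendsto_const) auto
    moreover have "\<forall>\<^sub>F k in sequentially. inverse (of_nat k) ^ (?n - ?m) * d = T k"
      using eventually_gt_at_top[of 0]
    proof eventually_elim
      case (elim k)
      have "(of_nat k :: complex) ^ ?n = of_nat k ^ ?m * of_nat k ^ (?n - ?m)"
        using less by (simp flip: power_add)
      then show ?case using elim by (simp add: T_def power_inverse field_simps)
    qed
    ultimately have "T \<longlonglongrightarrow> 0 * d" by (rule Lim_transform_eventually)
    with T have "of_real D = 0 * d" by (rule LIMSEQ_unique)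
    with \<open>D > 0\<close> show ?thesis by simp
  next
    assume less: "?n < ?m"
    have "(\<lambda>k. T k * inverse (of_nat k) ^ (?m - ?n)) \<longlonglongrightarrow> of_real D * 0"
      using less by (intro tendsto_mult inv0 T) auto
    moreover have "\<forall>\<^sub>F k in sequentially. T k * inverse (of_nat k) ^ (?m - ?n) = d"
      using eventually_gt_at_top[of 0]
    proof eventually_elim
      case (elim k)
      have "(of_nat k :: complex) ^ ?m = of_nat k ^ ?n * of_nat k ^ (?m - ?n)"
        using less by (simp flip: power_add)
      then show ?case using elim by (simp add: T_def power_inverse field_simps)
    qed
    ultimately have "(\<lambda>_::nat. d) \<longlonglongrightarrow> of_real D * 0" by (rule Lim_transform_eventually)
    then have "d = of_real D * 0" by (simp add: LIMSEQ_const_iff)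
    with \<open>d \<noteq> 0\<close> show ?thesis by simp
  qed
  moreover have "d = of_real D"
  proof (rule LIMSEQ_unique[OF _ T])
    have "\<forall>\<^sub>F k in sequentially. d = T k"
      using eventually_gt_at_top[of 0] by eventually_elim (simp add: T_def \<open>?m = ?n\<close>)
    with tendsto_const show "T \<longlonglongrightarrow> d" by (rule Lim_transform_eventually)
  qed
  ultimately show ?thesis by simp
qed

lemma poly_nonzero_far:
  fixes P :: "complex poly"
  assumes "P \<noteq> 0"
  obtains W where "\<forall>z. norm z > W \<longrightarrow> poly P z \<noteq> 0"
proof -
  have "bounded {z. poly P z = 0}"
    using assms by (intro finite_imp_bounded poly_roots_finite)
  then obtain W where "\<forall>z\<in>{z. poly P z = 0}. norm z \<le> W"
    by (auto simp: bounded_iff)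
  then show thesis by (intro that[of W]) force
qed

lemma add_notin_nonpos_Ints:
  fixes u :: complex
  assumes "s > norm u"
  shows "of_real s + u \<notin> \<int>\<^sub>\<le>\<^sub>0"
proof
  assume "of_real s + u \<in> \<int>\<^sub>\<le>\<^sub>0"
  then obtain n where "of_real s + u = - of_nat n" by (auto elim!: nonpos_Ints_cases')
  then have "s + Re u = - real n" by (simp add: complex_eq_iff)
  moreover have "\<bar>Re u\<bar> \<le> norm u" by (rule abs_Re_le_cmod)
  ultimately show False using assms by linarith
qed

text \<open>Write S = A/B with real polynomials. The ratio identity holds only off a sparse set;
  cleared of denominators it holds at each large real point, where all factors are nonzero and may
  be divided out again.\<close>

lemma canonical_form_recurrence:
  fixes F :: "real \<Rightarrow> real" and u v :: "nat \<Rightarrow> complex"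
  assumes "\<bar>x\<bar> < 1" "r > 0" "closed_form p q r a b x" "canonical_form (hgf_ratio p q r a b x) S d m u n v"
    and F: "\<And>s. s > K \<Longrightarrow> F s > 0"
    "\<And>s. s > K \<Longrightarrow> hgf p q r a b x (of_real s) = of_real (F s)"
  obtains A B :: "complex poly" and W :: real where
    "A \<noteq> 0" "B \<noteq> 0" "\<forall>i. coeff A i \<in> \<real> \<and> coeff B i \<in> \<real>" "\<forall>\<^sub>\<approx>w\<in>UNIV. S w = poly A w / poly B w"
    "W \<ge> K" "W \<ge> 0" "\<forall>s>W. poly A (of_real s) \<noteq> 0 \<and> poly B (of_real s) \<noteq> 0"
    "\<forall>s>W. (\<forall>i\<in>{1..m}. of_real s + u i \<notin> \<int>\<^sub>\<le>\<^sub>0) \<and> (\<forall>i\<in>{1..n}. of_real s + v i \<notin> \<int>\<^sub>\<le>\<^sub>0)"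
    "\<forall>s>W. of_real (F (s + 1) / F s) =
       poly A (of_real s + 1) / poly A (of_real s) * (poly B (of_real s) / poly B (of_real s + 1)) * d *
       (poly (\<Prod>i=1..m. [:u i, 1:]) (of_real s) / poly (\<Prod>i=1..n. [:v i, 1:]) (of_real s))"
proof -
  note cf = assms(4)[unfolded canonical_form_def]
  have "rational_over \<real> (hgf_ratio p q r a b x)"
    by (rule hgf_ratio_rational_over_Reals[OF assms(1-3) F])
  with cf have "rational_over \<real> S" by blast
  then obtain A B where AB: "B \<noteq> 0" "\<forall>i. coeff A i \<in> \<real> \<and> coeff B i \<in> \<real>"
    "\<forall>\<^sub>\<approx>w\<in>UNIV. S w = poly A w / poly B w"
    by (auto simp: rational_over_def)
  have "A \<noteq> 0"
  proof
    assume "A = 0"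
    with AB(3) have "\<forall>\<^sub>\<approx>w\<in>UNIV. S w = 0" by simp
    with cf show False by blast
  qed
  define U where "U = (\<Prod>i=1..m. [:u i, 1:])"
  define V where "V = (\<Prod>i=1..n. [:v i, 1:])"
  have V: "V \<noteq> 0" by (simp add: V_def)
  have polyUV: "poly U w = (\<Prod>i=1..m. w + u i)" "poly V w = (\<Prod>i=1..n. w + v i)" for w
    by (simp_all add: U_def V_def poly_prod add.commute)
  have ratio: "\<forall>\<^sub>\<approx>w\<in>UNIV. hgf_ratio p q r a b x w = S (w + 1) / S w * d * (poly U w / poly V w)"
    using cf by (simp add: polyUV)
  obtain WA where WA: "\<forall>z. norm z > WA \<longrightarrow> poly A z \<noteq> 0" by (rule poly_nonzero_far[OF \<open>A \<noteq> 0\<close>])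
  obtain WB where WB: "\<forall>z. norm z > WB \<longrightarrow> poly B z \<noteq> 0" by (rule poly_nonzero_far[OF AB(1)])
  \<comment> \<open>Beyond \<open>W\<close> lie no real roots of \<open>A\<close> or
    \<open>B\<close>, and \<open>s + u i\<close>, \<open>s + v i\<close> have positive real
    part.\<close>
  define W where "W = Max ({K, 0, WA, WB} \<union> (norm \<circ> u) ` {1..m} \<union> (norm \<circ> v) ` {1..n})"
  have Wge: "y \<le> W" if "y \<in> {K, 0, WA, WB} \<union> (norm \<circ> u) ` {1..m} \<union> (norm \<circ> v) ` {1..n}" for y
    unfolding W_def using that by (intro Max_ge) auto
  have W: "K \<le> W" "0 \<le> W" "WA \<le> W" "WB \<le> W"
    by (intro Wge; simp)+
  have Wu: "norm (u i) \<le> W" if "i \<in> {1..m}" for i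
    using that by (intro Wge) auto
  have Wv: "norm (v i) \<le> W" if "i \<in> {1..n}" for i
    using that by (intro Wge) auto
  have uv: "\<forall>s>W. (\<forall>i\<in>{1..m}. of_real s + u i \<notin> \<int>\<^sub>\<le>\<^sub>0) \<and> (\<forall>i\<in>{1..n}. of_real s + v i \<notin> \<int>\<^sub>\<le>\<^sub>0)"
    by (intro allI impI conjI ballI add_notin_nonpos_Ints) (use Wu Wv in \<open>blast intro: order.strict_trans1\<close>)+
  have nz: "poly A (of_real s) \<noteq> 0" "poly B (of_real s) \<noteq> 0" if "s > W" for s
    using WA WB W that by auto
  have Vnz: "poly V (of_real s) \<noteq> 0" if "s > W" for s
    using uv that by (force simp: polyUV)
  have poly1: "poly P (w + 1) = poly (pcompose P [:1, 1:]) w" for P :: "complex poly" and w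
    by (simp add: poly_pcompose add.commute)
  have rec: "\<forall>\<^sub>\<approx>w\<in>UNIV. hgf_ratio p q r a b x w * (poly A w * poly B (w + 1) * poly V w) =
      poly A (w + 1) * poly B w * d * poly U w"
    using ratio AB(3) eventually_cosparse_UNIV_shift[OF AB(3), of 1]
      eventually_cosparse_poly_nonzero[OF \<open>A \<noteq> 0\<close>] eventually_cosparse_poly_nonzero[OF AB(1)]
      eventually_cosparse_UNIV_shift[OF eventually_cosparse_poly_nonzero[OF AB(1)], of 1]
      eventually_cosparse_poly_nonzero[OF V]
    by eventually_elim simp
  have main: "of_real (F (s + 1) / F s) =
       poly A (of_real s + 1) / poly A (of_real s) * (poly B (of_real s) / poly B (of_real s + 1)) * d *
       (poly U (of_real s) / poly V (of_real s))" if "s > W" for s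
  proof -
    have s: "s > K" "s > 0" "s + 1 > K" using that W by auto
    have "hgf p q r a b x (of_real s + 1) * (poly A (of_real s) * poly B (of_real s + 1) * poly V (of_real s)) =
      hgf p q r a b x (of_real s) * (poly A (of_real s + 1) * poly B (of_real s) * d * poly U (of_real s))"
      using F(1)[of s] F(2)[of s] s by (intro hgf_recurrence_of_ratio[OF assms(1,2) _ _ rec])
        (auto simp: poly1 intro!: continuous_intros)
    moreover have "hgf p q r a b x (of_real s + 1) = of_real (F (s + 1))"
      using F(2)[of "s + 1"] s by simp
    moreover have "poly B (of_real s + 1) \<noteq> 0"
      using nz(2)[of "s + 1"] that by simp
    ultimately show ?thesis
      using F(1)[of s] F(2)[of s] s nz[OF that] Vnz[OF that] by (simp add: field_simps)
  qed
  show thesis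
    using nz main by (intro that[OF \<open>A \<noteq> 0\<close> AB W(1,2) _ uv]) (auto simp: U_def V_def)
qed

lemma islimpt_of_real_greaterThan: "complex_of_real (W + 1) islimpt of_real ` {W<..}"
  unfolding islimpt_approachable
proof (intro allI impI)
  fix e :: real assume "e > 0"
  then have "dist (complex_of_real (W + 1 + e / 2)) (of_real (W + 1)) < e"
    by (simp add: dist_norm)
  then show "\<exists>x'\<in>complex_of_real ` {W<..}. x' \<noteq> of_real (W + 1) \<and> dist x' (of_real (W + 1)) < e"
    using \<open>e > 0\<close> by (intro bexI[of _ "complex_of_real (W + 1 + e / 2)"]) (auto simp: complex_eq_iff)
qed

text \<open>This includes the poles: there \<open>Gamma\<close> is 0 by convention, and
  \<open>inverse 0 = 0\<close> agrees with the zero of \<open>rGamma\<close>.\<close>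

lemma prod_rGamma: "(\<Prod>i\<in>I. rGamma (f i)) = inverse (\<Prod>i\<in>I. Gamma (f i))"
  by (simp add: rGamma_inverse_Gamma prod_inversef[unfolded o_def])

text \<open>In terms of \<open>rGamma\<close> and the regularised series both sides are entire, so
  equality on a half-line extends to the plane by the identity theorem.\<close>

lemma gamma_product_identity:
  fixes p q r a b x :: real and u v :: "nat \<Rightarrow> complex"
  assumes "0 < p" "p < r" "\<bar>x\<bar> < 1" "closed_form p q r a b x"
    and "canonical_form (hgf_ratio p q r a b x) S d m u n v"
  obtains A B :: "complex poly" and c D :: real where
    "m = n" "D > 0" "d = of_real D" "c \<noteq> 0" "A \<noteq> 0" "B \<noteq> 0" "\<forall>\<^sub>\<approx>w\<in>UNIV. S w = poly A w / poly B w"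
    "\<forall>w. hgf_reg p q r a b x w * poly B w * (\<Prod>i=1..m. rGamma (w + u i)) =
      of_real c * poly A w * exp (w * of_real (ln D)) * rGamma (of_real r * w) * (\<Prod>i=1..m. rGamma (w + v i))"
proof -
  have r: "r > 0" using assms by simp
  obtain K D F where D: "D > 0" and F: "\<forall>s>K. F s > 0"
    "\<forall>s>K. hgf p q r a b x (of_real s) = of_real (F s)"
    and lim: "\<forall>\<sigma>>0. ((\<lambda>y. F (y + \<sigma>) / F y) \<longlongrightarrow> D powr \<sigma>) at_top"
    by (rule hgf_real_shift_ratio[OF assms(1-3), of q a b]) (rule that)
  note F = F[rule_format] and lim = lim[rule_format]
  obtain A B W where AB: "A \<noteq> 0" "B \<noteq> 0" "\<forall>i. coeff A i \<in> \<real> \<and> coeff B i \<in> \<real>"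
      "\<forall>\<^sub>\<approx>w\<in>UNIV. S w = poly A w / poly B w"
    and W: "W \<ge> K" "W \<ge> 0" "\<forall>s>W. poly A (of_real s) \<noteq> 0 \<and> poly B (of_real s) \<noteq> 0"
    and uv: "\<forall>s>W. (\<forall>i\<in>{1..m}. of_real s + u i \<notin> \<int>\<^sub>\<le>\<^sub>0) \<and> (\<forall>i\<in>{1..n}. of_real s + v i \<notin> \<int>\<^sub>\<le>\<^sub>0)"
    and rec: "\<forall>s>W. of_real (F (s + 1) / F s) =
       poly A (of_real s + 1) / poly A (of_real s) * (poly B (of_real s) / poly B (of_real s + 1)) * d *
       (poly (\<Prod>i=1..m. [:u i, 1:]) (of_real s) / poly (\<Prod>i=1..n. [:v i, 1:]) (of_real s))"
    by (rule canonical_form_recurrence[OF assms(3) r assms(4,5) F]) (assumption, assumption, rule that)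
  have cf: "d \<noteq> 0"
    using assms(5) by (simp add: canonical_form_def)
  have "rational_over \<real> (hgf_ratio p q r a b x)"
    by (rule hgf_ratio_rational_over_Reals[OF assms(3) r assms(4) F])
  then have reals: "\<forall>k. coeff (\<Prod>i=1..m. [:u i, 1:]) k \<in> \<real>" "\<forall>k. coeff (\<Prod>j=1..n. [:v j, 1:]) k \<in> \<real>"
    using assms(5) unfolding canonical_form_def by blast+
  have "degree (\<Prod>i=1..m. [:u i, 1:]) = degree (\<Prod>i=1..n. [:v i, 1:]) \<and> d = of_real D"
  proof (rule canonical_form_degree[where A = A and B = B and W = W and F = F])
    show "((\<lambda>y. F (y + 1) / F y) \<longlongrightarrow> D) at_top"
      using lim[of 1] D by simp
    show "lead_coeff (\<Prod>i=1..m. [:u i, 1:]) = 1" "lead_coeff (\<Prod>i=1..n. [:v i, 1:]) = 1"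
      by (rule monic_linear_prod)+
  qed (use D W(3) rec cf in blast)+
  then have mn: "m = n" and d: "d = of_real D"
    using monic_linear_prod(1) by auto
  \<comment> \<open>The sum is the subleading coefficient; \<open>m = 0\<close> is treated apart, as
    there the index \<open>m - 1\<close> is truncated.\<close>
  have "(\<Sum>i=1..m. y i) \<in> \<real>" if "\<forall>k. coeff (\<Prod>i=1..m. [:y i, 1:]) k \<in> \<real>" for y :: "nat \<Rightarrow> complex"
    using that monic_linear_prod(3)[of m y] by (cases "m = 0") (simp, metis gr0I)
  with reals mn have sums: "(\<Sum>i=1..m. u i) - (\<Sum>i=1..m. v i) \<in> \<real>"
    by (simp add: Reals_diff)
  obtain c where c: "c \<noteq> 0" "\<forall>s>W. of_real (F s) = of_real c * (poly A (of_real s) / poly B (of_real s)) * of_real (D powr s) *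
      ((\<Prod>i=1..m. Gamma (of_real s + u i)) / (\<Prod>i=1..m. Gamma (of_real s + v i)))"
  proof (rule gamma_product_on_half_line[of D W F A B m u v, OF D _ lim])
    show "F s > 0" if "s > W" for s
      using F(1) W(1) that by simp
    show "of_real (F (s + 1) / F s) =
       poly A (of_real s + 1) / poly A (of_real s) * (poly B (of_real s) / poly B (of_real s + 1)) * of_real D *
       ((\<Prod>i=1..m. of_real s + u i) / (\<Prod>i=1..m. of_real s + v i))" if "s > W" for s
    proof -
      have "poly (\<Prod>i=1..m. [:y i, 1:]) z = (\<Prod>i=1..m. z + y i)" for y :: "nat \<Rightarrow> complex" and z
        by (simp add: poly_prod add.commute)
      then show ?thesis
        using rec[rule_format, OF that] by (simp only: mn d)
    qed
  qed (use W uv sums AB mn in auto)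
  define L where "L = (\<lambda>w. hgf_reg p q r a b x w * poly B w * (\<Prod>i=1..m. rGamma (w + u i)))"
  define R where "R = (\<lambda>w. of_real c * poly A w * exp (w * of_real (ln D)) * rGamma (of_real r * w) * (\<Prod>i=1..m. rGamma (w + v i)))"
  have real_eq: "L (of_real s) - R (of_real s) = 0" if s: "s > W" for s
  proof -
    have "of_real r * complex_of_real s \<notin> \<int>\<^sub>\<le>\<^sub>0"
      using add_notin_nonpos_Ints[of 0 "r * s"] r s W(2) by simp
    then have reg: "hgf_reg p q r a b x (of_real s) = rGamma (of_real r * of_real s) * of_real (F s)"
      using hgf_eq_Gamma_mult_reg[OF assms(3), of r "of_real s" p q a b] F(2)[of s] s W(1)
      by (simp add: rGamma_inverse_Gamma Gamma_eq_zero_iff field_simps)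
    have "Gamma (of_real s + u i) \<noteq> 0" if "i \<in> {1..m}" for i
      using uv s that by (simp add: Gamma_eq_zero_iff)
    then have Gu: "(\<Prod>i=1..m. Gamma (of_real s + u i)) \<noteq> 0"
      by simp
    have "complex_of_real (D powr s) = exp (of_real s * of_real (ln D))"
      using D by (simp add: powr_def exp_of_real flip: of_real_mult)
    then show ?thesis
      unfolding L_def R_def reg c(2)[rule_format, OF s] prod_rGamma
      using W(3) s Gu by (simp add: field_simps)
  qed
  have "L w - R w = 0" for w
  proof (rule analytic_continuation[of "\<lambda>w. L w - R w" UNIV "of_real ` {W<..}" "of_real (W + 1)"])
    show "(\<lambda>w. L w - R w) holomorphic_on UNIV"
      unfolding L_def R_def using assms(3) by (intro holomorphic_intros) auto
  qed (use real_eq islimpt_of_real_greaterThan in auto)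
  then have "\<forall>w. L w = R w" by simp
  then show thesis
    by (intro that[OF mn D d c(1) AB(1,2,4)]) (simp add: L_def R_def)
qed

section \<open>Zeros of reciprocal gamma functions and the parameters\<close>

text \<open>Distinct exceptional points are at least 1/|c| apart, so they form a closed discrete
  set; leaving out \<open>z\<close> puts \<open>z\<close> in the open complement.\<close>

lemma eventually_at_affine_notin_nonpos_Ints:
  fixes c e z :: complex
  assumes "c \<noteq> 0"
  shows "\<forall>\<^sub>F w in at z. c * w + e \<notin> \<int>\<^sub>\<le>\<^sub>0"
proof -
  define T where "T = {w. c * w + e \<in> \<int>\<^sub>\<le>\<^sub>0 \<and> w \<noteq> z}"
  have "closed T"
  proof (rule discrete_imp_closed[of "1 / norm c"])
    show "\<forall>x\<in>T. \<forall>y\<in>T. dist y x < 1 / norm c \<longrightarrow> y = x"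
    proof (intro ballI impI)
      fix x y assume "x \<in> T" "y \<in> T" and dist: "dist y x < 1 / norm c"
      then obtain i j where ij: "c * x + e = - of_nat i" "c * y + e = - of_nat j"
        by (auto simp: T_def elim!: nonpos_Ints_cases')
      have "c * (y - x) = (c * y + e) - (c * x + e)"
        by (simp add: algebra_simps)
      also have "\<dots> = of_int (int i - int j)"
        unfolding ij by simp
      finally have eq: "c * (y - x) = of_int (int i - int j)" .
      have "norm c * norm (y - x) < 1"
        using dist assms by (simp add: dist_norm field_simps)
      then have "norm (c * (y - x)) < 1"
        by (simp only: norm_mult)
      then have "\<bar>int i - int j\<bar> < 1"
        unfolding eq norm_of_int by linarith
      then have "c * (y - x) = 0"
        unfolding eq by simp
      with assms show "y = x" by simp
    qed
  qed (use assms in auto)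
  then have "open (- T)" by (simp add: open_Compl)
  moreover have "z \<in> - T" by (simp add: T_def)
  ultimately have "\<forall>\<^sub>F w in at z. w \<in> - T - {z}"
    by (intro eventually_at_in_open)
  then show ?thesis
    by eventually_elim (auto simp: T_def)
qed

text \<open>At \<open>-n\<close> the derivative is \<open>(-1) ^ n * fact n\<close>. Simplicity of
  these zeros will rule out coinciding zeros of two factors \<open>rGamma (w + u i)\<close>.\<close>

lemma rGamma_simple_zero:
  fixes z :: complex
  assumes "z \<in> \<int>\<^sub>\<le>\<^sub>0"
  obtains D where "D \<noteq> 0" "(rGamma has_field_derivative D) (at z)"
proof -
  obtain n where "z = - of_nat n" using assms by (auto elim!: nonpos_Ints_cases')
  then show thesis
    using has_field_derivative_rGamma_nonpos_int[of n "UNIV :: complex set"]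
    by (intro that[of "(-1) ^ n * fact n"]) auto
qed

text \<open>Zeros are compared at \<open>- u i - k\<close> for large \<open>k\<close>. There
  \<open>h\<close>, the right side without \<open>rGamma (of_real r * w)\<close>, is nonzero, so
  \<open>r * w\<close> must be a nonpositive integer. Consecutive \<open>k\<close> give integrality
  of \<open>r\<close>, then of \<open>r * u i\<close>.\<close>

lemma gamma_product_parameters:
  fixes p q r a b x :: real and u v :: "nat \<Rightarrow> complex" and A B :: "complex poly"
  assumes "\<bar>x\<bar> < 1" "r > 0" "c \<noteq> 0" "A \<noteq> 0"
    and id: "\<And>w. G w * (\<Prod>i=1..m. rGamma (w + u i)) =
      of_real c * poly A w * exp (w * e) * rGamma (of_real r * w) * (\<Prod>i=1..m. rGamma (w + v i))"
    and G: "G holomorphic_on UNIV"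
    and uv: "\<And>i j. i \<in> {1..m} \<Longrightarrow> j \<in> {1..m} \<Longrightarrow> u i - v j \<notin> \<int>"
    and "m > 0"
  shows "\<exists>N::int. r = of_int N \<and> int m \<le> N \<and>
           (\<exists>s :: nat \<Rightarrow> int.
              (\<forall>i\<in>{1..m}. \<forall>j\<in>{1..m}. i \<noteq> j \<longrightarrow> s i mod N \<noteq> s j mod N) \<and>
              (\<forall>i\<in>{1..m}. u i = of_int (s i) / of_real r))"
proof -
  obtain W where W: "\<forall>z. norm z > W \<longrightarrow> poly A z \<noteq> 0"
    by (rule poly_nonzero_far[OF assms(4)])
  define h where "h = (\<lambda>w. of_real c * poly A w * exp (w * e) * (\<Prod>i=1..m. rGamma (w + v i)))"
  define z where "z = (\<lambda>i k. - u i - of_nat k)"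
  have h_nz: "h (z i k) \<noteq> 0" if i: "i \<in> {1..m}" and k: "real k > W + norm (u i)" for i k
  proof -
    have "real k = norm (- z i k - u i)"
      by (simp add: z_def)
    also have "\<dots> \<le> norm (z i k) + norm (u i)"
      using norm_triangle_ineq4[of "- z i k" "u i"] by simp
    finally have "real k \<le> norm (z i k) + norm (u i)" .
    then have "poly A (z i k) \<noteq> 0"
      using W k by simp
    \<comment> \<open>Otherwise \<open>u i - v j\<close>, which equals
      \<open>- (z i k + v j) - k\<close>, would be an integer.\<close>
    moreover have "z i k + v j \<notin> \<int>\<^sub>\<le>\<^sub>0" if j: "j \<in> {1..m}" for j
    proof
      assume "z i k + v j \<in> \<int>\<^sub>\<le>\<^sub>0"
      then have "- (z i k + v j) - of_nat k \<in> \<int>"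
        by (intro Ints_diff Ints_minus Ints_of_nat) (auto dest: nonpos_Ints_Int)
      then show False using uv[OF i j] by (simp add: z_def)
    qed
    ultimately show ?thesis
      using assms(3) by (simp add: h_def rGamma_eq_zero_iff)
  qed
  have zero: "of_real r * z i k \<in> \<int>\<^sub>\<le>\<^sub>0" if i: "i \<in> {1..m}" and k: "real k > W + norm (u i)" for i k
  proof -
    have "rGamma (z i k + u i) = 0"
      by (simp add: z_def rGamma_eq_zero_iff)
    then have "(\<Prod>j=1..m. rGamma (z i k + u j)) = 0"
      using i by (intro prod_zero) auto
    moreover have "h (z i k) * rGamma (of_real r * z i k) = G (z i k) * (\<Prod>j=1..m. rGamma (z i k + u j))"
      unfolding id by (simp add: h_def mult_ac)
    ultimately have "h (z i k) * rGamma (of_real r * z i k) = 0"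
      by (simp only: mult_zero_right)
    then show ?thesis
      using h_nz[OF i k] by (simp add: rGamma_eq_zero_iff)
  qed
  \<comment> \<open>An integer difference would give the left side a zero of order at least 2 at
    some \<open>z i k\<close>, where the right side has a simple one; the derivatives there would
    disagree.\<close>
  have distinct: "u i - u j \<notin> \<int>" if ij: "i \<in> {1..m}" "j \<in> {1..m}" "i \<noteq> j" for i j
  proof
    assume "u i - u j \<in> \<int>"
    then obtain l where l: "u i - u j = of_int l" by (auto elim: Ints_cases)
    \<comment> \<open>The bound \<open>\<bar>l\<bar>\<close> makes
      \<open>z i k + u j = - l - k\<close> a nonpositive integer too.\<close>
    obtain k :: nat where k: "real k > max (W + norm (u i)) (real_of_int \<bar>l\<bar>)"
      using reals_Archimedean2 by blast
    let ?z = "z i k"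
    have "?z + u i = of_int (- int k)"
      by (simp add: z_def)
    then have zi: "rGamma (?z + u i) = 0"
      unfolding rGamma_eq_zero_iff by (auto simp: nonpos_Ints_of_int)
    have "?z + u j = of_int (- l - int k)"
      using l by (simp add: z_def algebra_simps)
    moreover have "- l - int k \<le> 0"
      using k by linarith
    ultimately have zj: "rGamma (?z + u j) = 0"
      unfolding rGamma_eq_zero_iff by (metis nonpos_Ints_of_int)
    define g where "g = (\<lambda>w. G w * (\<Prod>l\<in>{1..m} - {i, j}. rGamma (w + u l)))"
    have split: "(\<Prod>l=1..m. rGamma (w + u l)) = rGamma (w + u i) * (rGamma (w + u j) * (\<Prod>l\<in>{1..m} - {i, j}. rGamma (w + u l)))" for w
    proof -
      have "(\<Prod>l=1..m. rGamma (w + u l)) = rGamma (w + u i) * (\<Prod>l\<in>{1..m} - {i}. rGamma (w + u l))"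
        using ij by (intro prod.remove) auto
      also have "(\<Prod>l\<in>{1..m} - {i}. rGamma (w + u l)) = rGamma (w + u j) * (\<Prod>l\<in>{1..m} - {i} - {j}. rGamma (w + u l))"
        using ij by (intro prod.remove) auto
      also have "{1..m} - {i} - {j} = {1..m} - {i, j}" by auto
      finally show ?thesis .
    qed
    have lhs: "rGamma (w + u i) * (rGamma (w + u j) * g w) = h w * rGamma (of_real r * w)" for w
      using id[of w] unfolding split by (simp add: g_def h_def mult_ac)
    have holo: "(\<lambda>w. rGamma (w + u i)) holomorphic_on UNIV" "(\<lambda>w. rGamma (w + u j) * g w) holomorphic_on UNIV"
        "h holomorphic_on UNIV"
      unfolding g_def h_def using G by (auto intro!: holomorphic_intros)
    obtain D1 D2 D3 where D: "((\<lambda>w. rGamma (w + u i)) has_field_derivative D1) (at ?z)"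
        "((\<lambda>w. rGamma (w + u j) * g w) has_field_derivative D2) (at ?z)" "(h has_field_derivative D3) (at ?z)"
      using holo by (meson UNIV_I holomorphic_on_imp_differentiable_at open_UNIV field_differentiable_def)
    obtain D4 where D4: "D4 \<noteq> 0" "(rGamma has_field_derivative D4) (at (of_real r * ?z))"
      using rGamma_simple_zero[OF zero[OF ij(1)]] k by auto
    have "((\<lambda>w. rGamma (of_real r * w)) has_field_derivative D4 * of_real r) (at ?z)"
      by (rule DERIV_chain2[where f = rGamma and g = "\<lambda>w. of_real r * w", OF D4(2)]) (auto intro!: derivative_eq_intros)
    from DERIV_mult[OF D(3) this]
    have "((\<lambda>w. h w * rGamma (of_real r * w)) has_field_derivative h ?z * (D4 * of_real r)) (at ?z)"
      using zero[OF ij(1), of k] k by (simp add: rGamma_eq_zero_iff[THEN iffD2] mult.commute)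
    moreover have "((\<lambda>w. h w * rGamma (of_real r * w)) has_field_derivative 0) (at ?z)"
      using DERIV_mult[OF D(1,2)] by (simp add: zi zj lhs)
    ultimately have "h ?z * (D4 * of_real r) = 0"
      by (rule DERIV_unique)
    then show False
      using h_nz[OF ij(1), of k] k D4(1) assms(2) by simp
  qed
  have ru: "of_real r * u i \<in> \<int> \<and> complex_of_real r \<in> \<int>" if "i \<in> {1..m}" for i
  proof -
    obtain k :: nat where k: "real k > W + norm (u i)"
      using reals_Archimedean2 by blast
    have z: "of_real r * z i k \<in> \<int>" "of_real r * z i (Suc k) \<in> \<int>"
      using zero[OF that, of k] zero[OF that, of "Suc k"] k by (auto dest: nonpos_Ints_Int)
    then have "of_real r * z i k - of_real r * z i (Suc k) \<in> \<int>" by (rule Ints_diff)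
    then have r: "complex_of_real r \<in> \<int>" by (simp add: z_def algebra_simps)
    then have "complex_of_real r * of_nat k \<in> \<int>"
      by (rule Ints_mult) (rule Ints_of_nat)
    from Ints_diff[OF Ints_minus[OF z(1)] this] show ?thesis
      using r by (simp add: z_def algebra_simps)
  qed
  have "complex_of_real r \<in> \<int>"
    using ru[of 1] assms(8) by simp
  then obtain N where "complex_of_real r = of_int N" by (auto elim: Ints_cases)
  then have N: "r = of_int N"
    by (metis of_real_eq_iff of_real_of_int_eq)
  then have "N > 0" using assms(2) by simp
  have "\<forall>i\<in>{1..m}. \<exists>l. of_real r * u i = of_int l"
    using ru by (meson Ints_cases)
  then obtain s where s: "\<forall>i\<in>{1..m}. of_real r * u i = of_int (s i)"
    by metis
  have u: "u i = of_int (s i) / of_real r" if "i \<in> {1..m}" for i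
    using s that assms(2) by (simp add: field_simps)
  have neq: "s i mod N \<noteq> s j mod N" if ij: "i \<in> {1..m}" "j \<in> {1..m}" "i \<noteq> j" for i j
  proof
    assume "s i mod N = s j mod N"
    then have "N dvd s i - s j" by (simp add: mod_eq_dvd_iff)
    then obtain l where "s i - s j = N * l" by (elim dvdE)
    then have "s i = s j + N * l" by simp
    then have "of_int N * (u i - u j) = of_int N * of_int l"
      using u[OF ij(1)] u[OF ij(2)] \<open>N > 0\<close> by (simp add: N right_diff_distrib)
    then have "u i - u j = of_int l"
      using \<open>N > 0\<close> by simp
    with distinct[OF ij] show False by simp
  qed
  \<comment> \<open>Pigeonhole: the \<open>m\<close> residues modulo \<open>N\<close> are
    distinct.\<close>
  have "inj_on (\<lambda>i. s i mod N) {1..m}"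
    by (rule inj_onI) (use neq in blast)
  then have "card {1..m} \<le> card {0..<N}"
    using \<open>N > 0\<close> by (intro card_inj_on_le) auto
  then have "int m \<le> N" using \<open>N > 0\<close> by simp
  then show ?thesis
    using N u neq by blast
qed

section \<open>Assembly of the conclusions\<close>

lemma gamma_product_formula:
  fixes p q r a b x :: real
    and S :: "complex \<Rightarrow> complex" and d :: complex
    and m n :: nat and u v :: "nat \<Rightarrow> complex"
  assumes "0 < p" "p < r" "\<bar>x\<bar> < 1"
    and "closed_form p q r a b x"
    and "canonical_form (hgf_ratio p q r a b x) S d m u n v"
  shows "m = n \<and>
     (\<exists>c::real. c \<noteq> 0 \<and>
        (\<forall>\<^sub>\<approx>w\<in>UNIV. hgf p q r a b x w =
           (of_real c * S w) * d powr w * ((\<Prod>i=1..m. Gamma (w + u i)) / (\<Prod>i=1..m. Gamma (w + v i))))) \<and>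
     (non_elementary p q r a b x \<longrightarrow>
        (\<exists>N::int. r = of_int N \<and> 1 \<le> m \<and> int m \<le> N \<and>
           (\<exists>s :: nat \<Rightarrow> int.
              (\<forall>i\<in>{1..m}. \<forall>j\<in>{1..m}. i \<noteq> j \<longrightarrow> s i mod N \<noteq> s j mod N) \<and>
              (\<forall>i\<in>{1..m}. u i = of_int (s i) / of_real r))))"
proof -
  have r: "r > 0" using assms by simp
  obtain A B :: "complex poly" and c D :: real where
    mn: "m = n" and D: "D > 0" "d = of_real D" and c: "c \<noteq> 0" and AB: "A \<noteq> 0" "B \<noteq> 0" "\<forall>\<^sub>\<approx>w\<in>UNIV. S w = poly A w / poly B w"
    and id: "\<forall>w. hgf_reg p q r a b x w * poly B w * (\<Prod>i=1..m. rGamma (w + u i)) =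
      of_real c * poly A w * exp (w * of_real (ln D)) * rGamma (of_real r * w) * (\<Prod>i=1..m. rGamma (w + v i))"
    by (rule gamma_product_identity[OF assms]) (rule that)
  let ?f = "hgf p q r a b x"
  have notin: "\<forall>\<^sub>F w in at z. w + y \<notin> \<int>\<^sub>\<le>\<^sub>0" for y z :: complex
    using eventually_at_affine_notin_nonpos_Ints[of 1 y z] by simp
  have notin_r: "\<forall>\<^sub>F w in at z. of_real r * w \<notin> \<int>\<^sub>\<le>\<^sub>0" for z :: complex
    using eventually_at_affine_notin_nonpos_Ints[of "of_real r" 0 z] r by simp
  \<comment> \<open>Away from the poles of Gamma(rw) the factor
    \<open>rGamma (of_real r * w)\<close> is nonzero and cancels from the entire identity.\<close>
  have f_eq: "?f w = of_real c * (poly A w / poly B w) * exp (w * of_real (ln D)) *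
      ((\<Prod>i=1..m. Gamma (w + u i)) / (\<Prod>i=1..m. Gamma (w + v i)))"
    if "of_real r * w \<notin> \<int>\<^sub>\<le>\<^sub>0" "poly B w \<noteq> 0" "\<forall>i\<in>{1..m}. w + u i \<notin> \<int>\<^sub>\<le>\<^sub>0" for w
  proof -
    have f: "?f w * rGamma (of_real r * w) = hgf_reg p q r a b x w"
      using hgf_eq_Gamma_mult_reg[OF assms(3) that(1)] that(1)
      by (simp add: rGamma_inverse_Gamma Gamma_eq_zero_iff)
    have rG: "rGamma (of_real r * w) \<noteq> 0"
      using that(1) by (simp add: rGamma_eq_zero_iff)
    have Gu: "(\<Prod>i=1..m. Gamma (w + u i)) \<noteq> 0"
      using that(3) by (auto simp: Gamma_eq_zero_iff)
    have "?f w * poly B w * rGamma (of_real r * w) * inverse (\<Prod>i=1..m. Gamma (w + u i)) =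
        of_real c * poly A w * exp (w * of_real (ln D)) * rGamma (of_real r * w) * inverse (\<Prod>i=1..m. Gamma (w + v i))"
      using id[rule_format, of w, folded f] by (simp only: prod_rGamma mult_ac)
    then have eq: "?f w * poly B w * inverse (\<Prod>i=1..m. Gamma (w + u i)) =
        of_real c * poly A w * exp (w * of_real (ln D)) * inverse (\<Prod>i=1..m. Gamma (w + v i))"
      using rG by (simp add: mult_ac)
    have "?f w = (?f w * poly B w * inverse (\<Prod>i=1..m. Gamma (w + u i))) * ((\<Prod>i=1..m. Gamma (w + u i)) / poly B w)"
      using Gu that(2) by simp
    then show ?thesis
      unfolding eq by (simp add: divide_inverse mult_ac)
  qed
  have d_powr: "d powr w = exp (w * of_real (ln D))" for w
    using D by (simp add: powr_def Ln_of_real)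
  have formula: "\<forall>\<^sub>\<approx>w\<in>UNIV. ?f w =
           (of_real c * S w) * d powr w * ((\<Prod>i=1..m. Gamma (w + u i)) / (\<Prod>i=1..m. Gamma (w + v i)))"
    unfolding eventually_cosparse_UNIV_iff
  proof
    fix z
    have "\<forall>\<^sub>F w in at z. \<forall>i\<in>{1..m}. w + u i \<notin> \<int>\<^sub>\<le>\<^sub>0"
      by (intro eventually_ball_finite ballI notin) auto
    moreover have "\<forall>\<^sub>F w in at z. S w = poly A w / poly B w" "\<forall>\<^sub>F w in at z. poly B w \<noteq> 0"
      using AB(3) eventually_cosparse_poly_nonzero[OF AB(2)] by (simp_all add: eventually_cosparse_UNIV_iff)
    ultimately show "\<forall>\<^sub>F w in at z. ?f w =
           (of_real c * S w) * d powr w * ((\<Prod>i=1..m. Gamma (w + u i)) / (\<Prod>i=1..m. Gamma (w + v i)))"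
      using notin_r[of z] by eventually_elim (simp add: f_eq d_powr)
  qed
  \<comment> \<open>Without gamma factors f is, off a sparse set, a rational function times D^w. Its
    poles are roots of \<open>B\<close>, hence finite in number, so the solution is
    elementary.\<close>
  have mpos: "m > 0" if "non_elementary p q r a b x"
  proof (rule ccontr)
    assume "\<not> m > 0"
    then have m: "m = 0" by simp
    have "{w. is_pole ?f w} \<subseteq> {w. poly B w = 0}"
    proof (safe, rule ccontr)
      fix z assume "is_pole ?f z" and z: "poly B z \<noteq> 0"
      have "\<forall>\<^sub>F w in at z. poly B w \<noteq> 0"
        using eventually_cosparse_poly_nonzero[OF AB(2)] by (simp add: eventually_cosparse_UNIV_iff)
      then have "\<forall>\<^sub>F w in at z. of_real c * (poly A w / poly B w) * exp (w * of_real (ln D)) = ?f w"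
        using notin_r[of z] by eventually_elim (simp add: f_eq m)
      moreover have "((\<lambda>w. of_real c * (poly A w / poly B w) * exp (w * of_real (ln D))) \<longlongrightarrow>
          of_real c * (poly A z / poly B z) * exp (z * of_real (ln D))) (at z)"
        using z by (intro tendsto_intros)
      ultimately have "(?f \<longlongrightarrow> of_real c * (poly A z / poly B z) * exp (z * of_real (ln D))) (at z)"
        by (rule Lim_transform_eventually[rotated])
      \<comment> \<open>A finite limit excludes a pole, whatever value \<open>?f\<close> takes at
        \<open>z\<close> itself.\<close>
      then show False
        using \<open>is_pole ?f z\<close> not_tendsto_and_filterlim_at_infinity[of "at z"] by (auto simp: is_pole_def)
    qed
    then have "finite {w. is_pole ?f w}"
      using poly_roots_finite[OF AB(2)] finite_subset by blast
    then show False
      using that by (simp add: non_elementary_def elementary_def)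
  qed
  have params: "\<exists>N::int. r = of_int N \<and> int m \<le> N \<and>
           (\<exists>s :: nat \<Rightarrow> int.
              (\<forall>i\<in>{1..m}. \<forall>j\<in>{1..m}. i \<noteq> j \<longrightarrow> s i mod N \<noteq> s j mod N) \<and>
              (\<forall>i\<in>{1..m}. u i = of_int (s i) / of_real r))" if "m > 0"
  proof (rule gamma_product_parameters[OF assms(3) r c AB(1) _ _ _ that])
    show "(\<lambda>w. hgf_reg p q r a b x w * poly B w) holomorphic_on UNIV"
      using assms(3) by (intro holomorphic_intros) auto
    show "u i - v j \<notin> \<int>" if "i \<in> {1..m}" "j \<in> {1..m}" for i j
      using assms(5) that unfolding canonical_form_def mn by blast
  qed (use id in blast)
  show ?thesis
  proof (intro conjI impI)
    assume "non_elementary p q r a b x"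
    then have "m > 0" by (rule mpos)
    moreover from params[OF this] obtain N :: int where "r = of_int N" "int m \<le> N"
      "\<exists>s :: nat \<Rightarrow> int.
              (\<forall>i\<in>{1..m}. \<forall>j\<in>{1..m}. i \<noteq> j \<longrightarrow> s i mod N \<noteq> s j mod N) \<and>
              (\<forall>i\<in>{1..m}. u i = of_int (s i) / of_real r)"
      by blast
    ultimately show "\<exists>N::int. r = of_int N \<and> 1 \<le> m \<and> int m \<le> N \<and>
           (\<exists>s :: nat \<Rightarrow> int.
              (\<forall>i\<in>{1..m}. \<forall>j\<in>{1..m}. i \<noteq> j \<longrightarrow> s i mod N \<noteq> s j mod N) \<and>
              (\<forall>i\<in>{1..m}. u i = of_int (s i) / of_real r))"
      by (intro exI[of _ N] conjI) simp_all
  qed (use mn c formula in blast)+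
qed

lemma hyp2F1_commute: "hyp2F1 \<alpha> \<beta> \<gamma> z = hyp2F1 \<beta> \<alpha> \<gamma> z"
  by (simp add: hyp2F1_def mult.commute)

text \<open>Exchanging (p, a) with (q, b) reduces the alternative \<open>0 < q < r\<close> of the
  theorem to \<open>0 < p < r\<close>.\<close>

lemma hgf_commute: "hgf p q r a b x = hgf q p r b a x"
  by (rule ext) (simp add: hgf_def hyp2F1_commute)

theorem theorem2p3:
  fixes p q r a b x :: real
    and S :: "complex \<Rightarrow> complex" and d :: complex
    and m n :: nat and u v :: "nat \<Rightarrow> complex"
  assumes "(0 < p \<and> p < r) \<or> (0 < q \<and> q < r)"
    and "-1 < x" and "x < 1" and "x \<noteq> 0"
    and "closed_form p q r a b x"
    and "canonical_form (hgf_ratio p q r a b x) S d m u n v"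
  shows "m = n \<and>
     (\<exists>c::real. c \<noteq> 0 \<and>
        (\<forall>\<^sub>\<approx>w\<in>UNIV. hgf p q r a b x w =
           (of_real c * S w) * d powr w * ((\<Prod>i=1..m. Gamma (w + u i)) / (\<Prod>i=1..m. Gamma (w + v i))))) \<and>
     (non_elementary p q r a b x \<longrightarrow>
        (\<exists>N::int. r = of_int N \<and> 1 \<le> m \<and> int m \<le> N \<and>
           (\<exists>s :: nat \<Rightarrow> int.
              (\<forall>i\<in>{1..m}. \<forall>j\<in>{1..m}. i \<noteq> j \<longrightarrow> s i mod N \<noteq> s j mod N) \<and>
              (\<forall>i\<in>{1..m}. u i = of_int (s i) / of_real r))))"
proof -
  have x: "\<bar>x\<bar> < 1" using assms by simp
  from assms(1) show ?thesis
  proof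
    assume "0 < p \<and> p < r"
    then show ?thesis
      using gamma_product_formula[OF _ _ x assms(5,6)] by blast
  next
    assume *: "0 < q \<and> q < r"
    have ratio: "hgf_ratio p q r a b x = hgf_ratio q p r b a x"
      by (rule ext) (simp add: hgf_ratio_def hgf_commute[of p])
    have cf: "closed_form p q r a b x = closed_form q p r b a x"
      by (simp add: closed_form_def ratio)
    have ne: "non_elementary p q r a b x = non_elementary q p r b a x"
      by (simp add: non_elementary_def elementary_def cf hgf_commute[of p])
    show ?thesis
      using gamma_product_formula[of q r x p b a S d m u n v] * x assms(5,6)
      unfolding ratio cf ne hgf_commute[of p q] by blast
  qed
qed

end
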